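(* Let $K/\mathbb{Q}$ be a finite Galois extension of degree $n$ with Galois group $G$, and let $h \mid n$ be a possible residue degree in $K/\mathbb{Q}$ (i.e. $G$ has a cyclic subgroup of order $h$). Let $\mu(K)$ be the group of roots of unity of $K$. Let $\eta \in K^\times$ be such that the multiplicative $\mathbb{Z}[G]$-module generated by $\eta$ (the subgroup of $K^\times$ generated by the conjugates $\eta^\sigma$, $\sigma\in G$) has $\mathbb{Z}$-rank $n$. Then for all sufficiently large prime numbers $p$, unramified in $K/\mathbb{Q}$, prime to $\eta$, with residue degree $n_p = h$, and for every prime ideal $\mathfrak p \mid p$ of $K$, the least integer $k \geq 1$ for which there exists $\zeta \in \mu(K)$ with $\eta^k \equiv \zeta \pmod{\mathfrak p}$ is a divisor of $p^h - 1$ which does not divide any of the integers $$D_{h,\delta}(p) := \frac{p^h - 1}{\Phi_\delta(p)}, \qquad \delta \mid h,$$ where $\Phi_\delta(X)$ is the $\delta$-th cyclotomic polynomial. Consequently, $o_{\mathfrak p}(\eta)$ and $o_p(\eta)$ do not divide any of the $D_{h,\delta}(p)$, $\delta\mid h$.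
   Context: For a prime $p$ unramified in $K/\mathbb{Q}$ and prime to $\eta$, and a prime ideal $\mathfrak p\mid p$, the order $o_{\mathfrak p}(\eta)$ is the least integer $k\ge 1$ with $\eta^k\equiv 1 \pmod{\mathfrak p}$, and the order $o_p(\eta)$ is the least integer $k \ge 1$ with $\eta^k \equiv 1 \pmod{p}$ (congruences taken in the ring of $p$-integral elements of $K$). The residue degree $n_p$ of $p$ is the common residue degree $[Z_K/\mathfrak p:\mathbb{F}_p]$ of the primes $\mathfrak p\mid p$. *)

theory Defs
  imports
    Complex_Main
    "HOL-Computational_Algebra.Computational_Algebra"
    "HOL-Algebra.Ideal_Product"
    "HOL-Algebra.QuotRing"
    "HOL-Algebra.Embedded_Algebras"
    "HOL-Algebra.Elementary_Groups"
begin

text \<open>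
  The field \<open>K\<close> is the whole type \<open>'a :: field_char_0\<close>; its prime field is \<open>range of_rat\<close>.
  Rings attached to \<open>K\<close> are records with the operations inherited from \<open>'a\<close>.
\<close>

definition rat_scale :: "rat \<Rightarrow> 'a \<Rightarrow> 'a::field_char_0" where
  "rat_scale q x = of_rat q * x"

global_interpretation rat_vs: vector_space "rat_scale :: rat \<Rightarrow> 'a \<Rightarrow> 'a::field_char_0"
  by unfold_locales (simp_all add: rat_scale_def algebra_simps of_rat_add of_rat_mult)

definition galois_group :: "('a::field_char_0 \<Rightarrow> 'a) monoid" where
  "galois_group =
     \<lparr>carrier = {\<sigma>. bij \<sigma> \<and> (\<forall>x y. \<sigma> (x + y) = \<sigma> x + \<sigma> y) \<and> (\<forall>x y. \<sigma> (x * y) = \<sigma> x * \<sigma> y)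
                 \<and> (\<forall>q. \<sigma> (of_rat q) = of_rat q)},
      monoid.mult = (\<circ>), one = id\<rparr>"

definition finite_galois_over_rat :: "'a::field_char_0 itself \<Rightarrow> bool" where
  "finite_galois_over_rat _ \<longleftrightarrow>
     (\<exists>B :: 'a set. finite B \<and> rat_vs.span B = UNIV) \<and>
     {x :: 'a. \<forall>\<sigma>\<in>carrier galois_group. \<sigma> x = x} = range of_rat"

definition degree_over_rat :: "'a::field_char_0 itself \<Rightarrow> nat" where
  "degree_over_rat _ = rat_vs.dim (UNIV :: 'a set)"

definition ring_of_integers :: "'a::field_char_0 ring" where
  "ring_of_integers =
     \<lparr>carrier = {x. algebraic_int x}, monoid.mult = (*), one = 1, zero = 0, add = (+)\<rparr>"

definition primes_above :: "nat \<Rightarrow> 'a::field_char_0 set set" where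
  "primes_above p = {P. primeideal P ring_of_integers \<and> of_nat p \<in> P}"

text \<open>The \<open>\<int>\<close>-multiples of \<open>1\<close> in the residue ring of \<open>P\<close> are the copy of \<open>\<int>/p\<close> in it.\<close>

definition residue_degree :: "'a::field_char_0 set \<Rightarrow> nat" where
  "residue_degree P =
     ring.dim (ring_of_integers Quot P)
       (range (\<lambda>m::int. P +>\<^bsub>ring_of_integers\<^esub> of_int m))
       (carrier (ring_of_integers Quot P))"

definition has_residue_degree :: "'a::field_char_0 itself \<Rightarrow> nat \<Rightarrow> nat \<Rightarrow> bool" where
  "has_residue_degree _ p f \<longleftrightarrow> (\<forall>P \<in> (primes_above p :: 'a set set). residue_degree P = f)"

definition ramification_index :: "nat \<Rightarrow> 'a::field_char_0 set \<Rightarrow> nat" where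
  "ramification_index p P =
     (GREATEST e. PIdl\<^bsub>ring_of_integers\<^esub> (of_nat p) \<subseteq> P [^]\<^bsub>ideals_set ring_of_integers\<^esub> e)"

definition unramified :: "'a::field_char_0 itself \<Rightarrow> nat \<Rightarrow> bool" where
  "unramified _ p \<longleftrightarrow> (\<forall>P \<in> (primes_above p :: 'a set set). ramification_index p P = 1)"

text \<open>\<open>x\<close> has valuation \<open>0\<close> at every prime ideal above \<open>p\<close>.\<close>

definition prime_to :: "nat \<Rightarrow> 'a::field_char_0 \<Rightarrow> bool" where
  "prime_to p x \<longleftrightarrow>
     (\<forall>P \<in> primes_above p. \<exists>a \<in> carrier ring_of_integers - P. \<exists>b \<in> carrier ring_of_integers - P.
        x = a / b)"

text \<open>
  The ring of \<open>p\<close>-integral elements: the localisation of the ring of integers at the integers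
  prime to \<open>p\<close>, which is the integral closure of \<open>\<int>\<close> localised at \<open>p\<close>.
\<close>

definition p_integers :: "nat \<Rightarrow> 'a::field_char_0 ring" where
  "p_integers p =
     \<lparr>carrier = {a / of_int m | a m. a \<in> carrier ring_of_integers \<and> \<not> int p dvd m},
      monoid.mult = (*), one = 1, zero = 0, add = (+)\<rparr>"

text \<open>
  Congruence of \<open>p\<close>-integral elements modulo the ideal generated by \<open>S\<close>; it is used with \<open>S\<close> a
  prime ideal above \<open>p\<close> and with \<open>S = {p}\<close>.
\<close>

definition p_cong :: "nat \<Rightarrow> 'a::field_char_0 set \<Rightarrow> 'a \<Rightarrow> 'a \<Rightarrow> bool" where
  "p_cong p S x y \<longleftrightarrow>
     x \<in> carrier (p_integers p) \<and> y \<in> carrier (p_integers p) \<and> x - y \<in> Idl\<^bsub>p_integers p\<^esub> S"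

definition roots_of_unity :: "'a::field_char_0 set" where
  "roots_of_unity = {\<zeta>. \<exists>m::nat. m > 0 \<and> \<zeta> ^ m = 1}"

definition order_mod_prime :: "nat \<Rightarrow> 'a::field_char_0 set \<Rightarrow> 'a \<Rightarrow> nat" where
  "order_mod_prime p P x = (LEAST k. k \<ge> 1 \<and> p_cong p P (x ^ k) 1)"

definition order_mod_p :: "nat \<Rightarrow> 'a::field_char_0 \<Rightarrow> nat" where
  "order_mod_p p x = (LEAST k. k \<ge> 1 \<and> p_cong p {of_nat p} (x ^ k) 1)"

definition order_mod_prime_roots :: "nat \<Rightarrow> 'a::field_char_0 set \<Rightarrow> 'a \<Rightarrow> nat" where
  "order_mod_prime_roots p P x =
     (LEAST k. k \<ge> 1 \<and> (\<exists>\<zeta> \<in> roots_of_unity. p_cong p P (x ^ k) \<zeta>))"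

definition mult_group :: "'a::field_char_0 monoid" where
  "mult_group = \<lparr>carrier = UNIV - {0}, monoid.mult = (*), one = 1\<rparr>"

definition galois_module :: "'a::field_char_0 \<Rightarrow> 'a set" where
  "galois_module x = generate mult_group ((\<lambda>\<sigma>. \<sigma> x) ` carrier galois_group)"

definition mult_independent :: "'a::field_char_0 set \<Rightarrow> bool" where
  "mult_independent S \<longleftrightarrow>
     finite S \<and> (\<forall>e :: 'a \<Rightarrow> int. (\<Prod>x\<in>S. x powi e x) = 1 \<longrightarrow> (\<forall>x\<in>S. e x = 0))"

text \<open>The \<open>\<int>\<close>-rank of a multiplicative subgroup: the maximal size of an independent subset.\<close>

definition has_mult_rank :: "'a::field_char_0 set \<Rightarrow> nat \<Rightarrow> bool" where
  "has_mult_rank M r \<longleftrightarrow>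
     (\<exists>S \<subseteq> M. mult_independent S \<and> card S = r) \<and>
     (\<forall>S \<subseteq> M. mult_independent S \<longrightarrow> card S \<le> r)"

definition primitive_roots_of_unity :: "nat \<Rightarrow> complex set" where
  "primitive_roots_of_unity d = {\<omega>. \<omega> ^ d = 1 \<and> (\<forall>k. 0 < k \<and> k < d \<longrightarrow> \<omega> ^ k \<noteq> 1)}"

text \<open>For \<open>d \<ge> 1\<close> the product below has integer coefficients.\<close>

definition cyclotomic_poly :: "nat \<Rightarrow> int poly" where
  "cyclotomic_poly d =
     (THE q. map_poly of_int q = (\<Prod>\<omega>\<in>primitive_roots_of_unity d. [:- \<omega>, 1:]))"

text \<open>For \<open>\<delta> dvd h\<close> and \<open>h \<ge> 1\<close> the division is exact.\<close>

definition D_quot :: "nat \<Rightarrow> nat \<Rightarrow> nat \<Rightarrow> int" where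
  "D_quot h \<delta> p = (int p ^ h - 1) div poly (cyclotomic_poly \<delta>) (int p)"

end

theory Submission
  imports Defs "Jordan_Normal_Form.Char_Poly" "HOL-Library.Set_Algebras" "HOL-Number_Theory.Residues"
begin

text \<open>
  By the rank hypothesis the \<open>n\<close> conjugates of \<open>\<eta>\<close> are multiplicatively independent, in particular
  distinct. Let \<open>p\<close> be so large that \<open>\<eta>\<close> and \<open>1/\<eta>\<close> are p-integral and Lagrange interpolation at the
  conjugates of \<open>\<eta>\<close> writes every p-integral element as a polynomial in \<open>\<eta>\<close> with p-integral rational
  coefficients. For \<open>f = (\<Prod>\<tau>. X - \<tau> \<eta>)\<close> we have \<open>f(\<eta>\<^sup>p) \<equiv> f(\<eta>)\<^sup>p = 0\<close> modulo a prime \<open>P\<close> above \<open>p\<close>, so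
  \<open>\<eta>\<^sup>p \<equiv> \<sigma> \<eta>\<close> for some \<open>\<sigma>\<close>, which is therefore a Frobenius element at \<open>P\<close>. If \<open>\<sigma>\<^sup>m = 1\<close> with \<open>m > 0\<close>, then
  \<open>X^(p^m) - X\<close> vanishes on the residue field; since that has \<open>p^h\<close> elements, \<open>m \<ge> h\<close>, and thus
  \<open>\<eta>, \<sigma> \<eta>, \<dots>, \<sigma>^(h-1) \<eta>\<close> are distinct.

  Write \<open>A = (X^h - 1) / \<Phi>\<^sub>\<delta> = (\<Sum>i<h. a\<^sub>i X^i)\<close>. If \<open>\<eta>^k\<close> is congruent to a root of unity modulo \<open>P\<close> and
  \<open>k\<close> divides \<open>A(p)\<close>, then so is \<open>\<eta>^A(p)\<close>, and with it \<open>\<Prod>i<h. (\<sigma>^i \<eta>)^a\<^sub>i\<close>, which by independence is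
  not itself a root of unity. There are only finitely many such products and finitely many roots of
  unity, so only finitely many \<open>p\<close> can divide a difference between them.
\<close>

hide_const (open) up_ring.coeff up_ring.monom Module.smult Ring_Hom.ring_hom
no_notation fps_nth (infixl "$" 75)

section \<open>Algebraic integers\<close>

interpretation int_module: Modules.module "\<lambda>(k::int) x. of_int k * (x :: 'a::comm_ring_1)"
  by unfold_locales (simp_all add: algebra_simps)

definition stabilizes :: "'a::comm_ring_1 \<Rightarrow> 'a set \<Rightarrow> bool" where
  "stabilizes z V \<longleftrightarrow> (\<forall>v\<in>V. z * v \<in> int_module.span V)"

lemma mult_in_int_span:
  assumes "\<And>v. v \<in> V \<Longrightarrow> z * v \<in> int_module.span W" and "v \<in> int_module.span V"
  shows "z * v \<in> int_module.span W"
  using assms(2)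
proof (induction rule: int_module.span_induct_alt)
  case (step c v u)
  then show ?case
    using int_module.span_add[OF int_module.span_scale[OF assms(1)], of v "z * u" c]
    by (simp add: algebra_simps)
qed (simp add: int_module.span_zero)

lemma stabilizes_add: "stabilizes x V \<Longrightarrow> stabilizes y V \<Longrightarrow> stabilizes (x + y) V"
  by (simp add: stabilizes_def distrib_right int_module.span_add)

lemma stabilizes_mult: "stabilizes x V \<Longrightarrow> stabilizes y V \<Longrightarrow> stabilizes (x * y) V"
  using mult_in_int_span[of V x V] by (simp add: stabilizes_def mult.assoc)

lemma stabilizes_times:
  assumes "stabilizes x V"
  shows "stabilizes x (V * W)"
  unfolding stabilizes_def
proof
  fix u assume "u \<in> V * W"
  then obtain v w where vw: "u = v * w" "v \<in> V" "w \<in> W" by (rule set_times_elim)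
  have "w * v' \<in> int_module.span (V * W)" if "v' \<in> V" for v'
    using set_times_intro[OF that vw(3)] by (intro int_module.span_base) (simp only: mult.commute)
  moreover have "x * v \<in> int_module.span V" using assms vw(2) by (simp add: stabilizes_def)
  ultimately have "w * (x * v) \<in> int_module.span (V * W)" by (rule mult_in_int_span)
  then show "x * u \<in> int_module.span (V * W)" by (simp only: vw(1) mult_ac)
qed

text \<open>Multiplication by \<open>z\<close> on the lattice spanned by \<open>V\<close> has an integer matrix with eigenvalue \<open>z\<close>.\<close>

lemma algebraic_int_if_stabilizes:
  fixes z :: "'a::field_char_0"
  assumes "finite V" "1 \<in> V" "stabilizes z V"
  shows "algebraic_int z"
proof -
  define n where "n = card V"
  obtain b where b: "bij_betw b {..<n} V"
    using ex_bij_betw_nat_finite[OF \<open>finite V\<close>] by (auto simp: n_def lessThan_atLeast0)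
  have "\<exists>u. z * v = (\<Sum>w\<in>V. of_int (u w) * w)" if "v \<in> V" for v
    using assms(3) that by (auto simp: stabilizes_def int_module.span_finite[OF \<open>finite V\<close>])
  then obtain u where u: "\<And>v. v \<in> V \<Longrightarrow> z * v = (\<Sum>w\<in>V. of_int (u v w) * w)"
    by metis
  define A where "A = mat n n (\<lambda>(i, j). u (b i) (b j))"
  have A: "A \<in> carrier_mat n n" by (simp add: A_def)
  obtain i where "i < n" "b i = 1" using b assms(2) by (auto simp: bij_betw_def)
  then have nonzero: "vec n b \<noteq> 0\<^sub>v n" by (metis index_vec index_zero_vec(1) zero_neq_one)
  have "map_mat of_int A *\<^sub>v vec n b = z \<cdot>\<^sub>v vec n b"
  proof (rule eq_vecI)
    fix i assume "i < dim_vec (z \<cdot>\<^sub>v vec n b)"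
    then have i: "i < n" by simp
    then have "b i \<in> V" using b by (auto simp: bij_betw_def)
    then have "z * b i = (\<Sum>j<n. of_int (u (b i) (b j)) * b j)"
      using u sum.reindex_bij_betw[OF b, of "\<lambda>w. of_int (u (b i) w) * w"] by simp
    then show "(map_mat of_int A *\<^sub>v vec n b) $ i = (z \<cdot>\<^sub>v vec n b) $ i"
      using i by (simp add: A_def scalar_prod_def lessThan_atLeast0)
  qed (simp add: A_def)
  then have "eigenvalue (map_mat of_int A) z"
    using A nonzero unfolding eigenvalue_def eigenvector_def by (intro exI[of _ "vec n b"]) auto
  then have "poly (of_int_poly (char_poly A)) z = 0"
    using A by (simp add: eigenvalue_root_char_poly[of _ n] of_int_hom.char_poly_hom[OF A])
  then show ?thesis
    using degree_monic_char_poly[OF A] by (auto intro!: algebraic_int.intros[of "of_int_poly (char_poly A)"])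
qed

lemma root_imp_stabilizes_powers:
  fixes x :: "'a::field_char_0"
  assumes "\<And>i. coeff f i \<in> \<int>" "poly f x = 0"
  shows "stabilizes (lead_coeff f * x) ((\<lambda>i. x ^ i) ` {..<degree f})"
  unfolding stabilizes_def
proof
  let ?V = "(\<lambda>i. x ^ i) ` {..<degree f}"
  have monomial: "coeff f j * x ^ i \<in> int_module.span ?V" if "i < degree f" for i j
  proof -
    obtain k where "coeff f j = of_int k" using assms(1) by (meson Ints_cases)
    then show ?thesis
      using int_module.span_scale[OF int_module.span_base, of "x ^ i" ?V k] that by simp
  qed
  fix v assume "v \<in> ?V"
  then obtain i where i: "i < degree f" "v = x ^ i" by blast
  show "lead_coeff f * x * v \<in> int_module.span ?V"
  proof (cases "Suc i = degree f")
    case True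
    have "lead_coeff f * x * v = - (\<Sum>j<degree f. coeff f j * x ^ j)"
      using assms(2) True i(2)
      by (simp add: poly_altdef lessThan_Suc_atMost[symmetric] eq_neg_iff_add_eq_0 add.commute
          mult.assoc flip: power_Suc)
    also have "\<dots> \<in> int_module.span ?V"
      by (intro int_module.span_neg int_module.span_sum monomial) simp
    finally show ?thesis .
  next
    case False
    then show ?thesis using monomial[of "Suc i" "degree f"] i by (simp add: mult.assoc)
  qed
qed

lemma algebraic_imp_stabilizes:
  fixes x :: "'a::field_char_0"
  assumes "f \<noteq> 0" "\<And>i. coeff f i \<in> \<int>" "poly f x = 0"
  shows "\<exists>V. finite V \<and> 1 \<in> V \<and> stabilizes (lead_coeff f * x) V"
proof (intro exI conjI)
  let ?V = "(\<lambda>i. x ^ i) ` {..<degree f}"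
  show "stabilizes (lead_coeff f * x) ?V" using assms(2,3) by (rule root_imp_stabilizes_powers)
  have "degree f > 0" using assms(1,3) by (auto intro!: gr0I elim!: degree_eq_zeroE)
  then show "1 \<in> ?V" by (auto intro!: image_eqI[of _ _ 0])
qed simp

lemma algebraic_obtain_algebraic_int_multiple:
  assumes "algebraic (x :: 'a::field_char_0)"
  obtains d :: int where "d \<noteq> 0" "algebraic_int (of_int d * x)"
proof -
  obtain f where f: "f \<noteq> 0" "\<And>i. coeff f i \<in> \<int>" "poly f x = 0"
    using assms by (auto elim: algebraicE)
  obtain d where d: "lead_coeff f = of_int d" using f(2) by (meson Ints_cases)
  have "algebraic_int (of_int d * x)"
    using algebraic_imp_stabilizes[OF f] algebraic_int_if_stabilizes unfolding d by blast
  moreover have "d \<noteq> 0" using d f(1) by auto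
  ultimately show ?thesis using that by blast
qed

lemma algebraic_int_iff_stabilizes:
  "algebraic_int (x :: 'a::field_char_0) \<longleftrightarrow> (\<exists>V. finite V \<and> 1 \<in> V \<and> stabilizes x V)"
proof
  assume "algebraic_int x"
  then obtain f where f: "lead_coeff f = 1" "\<And>i. coeff f i \<in> \<int>" "poly f x = 0"
    by (auto elim: algebraic_int.cases)
  have "f \<noteq> 0" using f(1) by auto
  from algebraic_imp_stabilizes[OF this f(2,3)] show "\<exists>V. finite V \<and> 1 \<in> V \<and> stabilizes x V"
    by (simp add: f(1))
qed (blast intro: algebraic_int_if_stabilizes)

lemma
  fixes x y :: "'a::field_char_0"
  assumes "algebraic_int x" "algebraic_int y"
  shows algebraic_int_add: "algebraic_int (x + y)" and algebraic_int_mult: "algebraic_int (x * y)"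
proof -
  obtain V W where V: "finite V" "1 \<in> V" "stabilizes x V" and W: "finite W" "1 \<in> W" "stabilizes y W"
    using assms unfolding algebraic_int_iff_stabilizes by blast
  have stable: "stabilizes x (V * W)" "stabilizes y (V * W)"
    using stabilizes_times[OF V(3), of W] stabilizes_times[OF W(3), of V] by (simp_all only: mult.commute)
  have "finite (V * W)" using V(1) W(1) by (rule finite_set_times)
  moreover have "1 \<in> V * W" using set_times_intro[OF V(2) W(2)] by simp
  ultimately show "algebraic_int (x + y)" "algebraic_int (x * y)"
    using stabilizes_add[OF stable] stabilizes_mult[OF stable] algebraic_int_if_stabilizes by blast+
qed

lemma algebraic_int_diff:
  "algebraic_int x \<Longrightarrow> algebraic_int y \<Longrightarrow> algebraic_int (x - y :: 'a::field_char_0)"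
  using algebraic_int_add[of x "- y"] by simp

lemma algebraic_int_power: "algebraic_int x \<Longrightarrow> algebraic_int (x ^ k :: 'a::field_char_0)"
  by (induction k) (simp_all add: algebraic_int_mult)

lemma ring_of_integers_simps [simp]:
  "carrier ring_of_integers = {x. algebraic_int x}"
  "x \<oplus>\<^bsub>ring_of_integers\<^esub> y = x + y" "x \<otimes>\<^bsub>ring_of_integers\<^esub> y = x * y"
  "\<zero>\<^bsub>ring_of_integers\<^esub> = 0" "\<one>\<^bsub>ring_of_integers\<^esub> = 1"
  by (simp_all add: ring_of_integers_def)

lemma cring_ring_of_integers: "cring (ring_of_integers :: 'a::field_char_0 ring)"
proof (rule cringI)
  show "abelian_group (ring_of_integers :: 'a ring)"
  proof (rule abelian_groupI)
    fix x :: 'a assume "x \<in> carrier ring_of_integers"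
    then show "\<exists>y\<in>carrier ring_of_integers. y \<oplus>\<^bsub>ring_of_integers\<^esub> x = \<zero>\<^bsub>ring_of_integers\<^esub>"
      by (intro bexI[of _ "- x"]) simp_all
  qed (simp_all add: algebraic_int_add add.assoc add.commute)
  show "comm_monoid (ring_of_integers :: 'a ring)"
    by (rule comm_monoidI) (simp_all add: algebraic_int_mult mult_ac)
qed (simp add: distrib_right)

section \<open>Automorphisms and conjugates\<close>

abbreviation Gal :: "('a::field_char_0 \<Rightarrow> 'a) set" where
  "Gal \<equiv> carrier galois_group"

lemma Gal_of_rat: "\<sigma> \<in> Gal \<Longrightarrow> \<sigma> (of_rat q) = of_rat q"
  by (simp add: galois_group_def)

lemma Gal_Rats:
  assumes "\<sigma> \<in> Gal" "x \<in> \<rat>"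
  shows "\<sigma> x = x"
  using assms(2) by (rule Rats_cases) (simp add: Gal_of_rat[OF assms(1)])

lemma Gal_bij: "\<sigma> \<in> Gal \<Longrightarrow> bij \<sigma>"
  by (simp add: galois_group_def)

lemma Gal_field_hom:
  assumes "\<sigma> \<in> Gal"
  shows "field_hom \<sigma>"
proof
  show "\<sigma> 0 = 0" "\<sigma> 1 = 1" using Gal_of_rat[OF assms, of 0] Gal_of_rat[OF assms, of 1] by simp_all
qed (use assms in \<open>auto simp: galois_group_def\<close>)

lemma
  assumes "\<sigma> \<in> Gal"
  shows Gal_zero: "\<sigma> 0 = 0" and Gal_one: "\<sigma> 1 = 1"
    and Gal_add: "\<sigma> (x + y) = \<sigma> x + \<sigma> y" and Gal_mult: "\<sigma> (x * y) = \<sigma> x * \<sigma> y"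
    and Gal_power: "\<sigma> (x ^ k) = \<sigma> x ^ k" and Gal_inverse: "\<sigma> (inverse x) = inverse (\<sigma> x)"
    and Gal_of_int: "\<sigma> (of_int m) = of_int m"
    and Gal_eq_zero_iff: "\<sigma> x = 0 \<longleftrightarrow> x = 0" and Gal_eq_iff: "\<sigma> x = \<sigma> y \<longleftrightarrow> x = y"
proof -
  interpret field_hom \<sigma> using assms by (rule Gal_field_hom)
  show "\<sigma> 0 = 0" "\<sigma> 1 = 1" "\<sigma> (x + y) = \<sigma> x + \<sigma> y" "\<sigma> (x * y) = \<sigma> x * \<sigma> y" "\<sigma> (x ^ k) = \<sigma> x ^ k"
    "\<sigma> (inverse x) = inverse (\<sigma> x)" "\<sigma> (of_int m) = of_int m" "\<sigma> x = 0 \<longleftrightarrow> x = 0" "\<sigma> x = \<sigma> y \<longleftrightarrow> x = y"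
    by (simp_all add: hom_distribs)
qed

lemmas Gal_hom = Gal_zero Gal_one Gal_add Gal_mult Gal_power Gal_inverse Gal_of_int

lemma id_in_Gal [simp]: "id \<in> Gal"
  by (simp add: galois_group_def)

lemma comp_in_Gal [simp]: "\<sigma> \<in> Gal \<Longrightarrow> \<tau> \<in> Gal \<Longrightarrow> \<sigma> \<circ> \<tau> \<in> Gal"
  by (auto simp: galois_group_def bij_comp)

lemma funpow_in_Gal [simp]: "\<sigma> \<in> Gal \<Longrightarrow> \<sigma> ^^ k \<in> Gal"
  by (induction k) auto

lemma inv_in_Gal:
  assumes "\<sigma> \<in> Gal"
  shows "inv_into UNIV \<sigma> \<in> Gal"
proof -
  interpret field_hom \<sigma> using assms by (rule Gal_field_hom)
  have "bij \<sigma>" using assms by (rule Gal_bij)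
  then have right_inv: "\<sigma> (inv_into UNIV \<sigma> x) = x" for x
    by (simp add: bij_is_surj surj_f_inv_f)
  have "inv_into UNIV \<sigma> (x + y) = inv_into UNIV \<sigma> x + inv_into UNIV \<sigma> y"
    "inv_into UNIV \<sigma> (x * y) = inv_into UNIV \<sigma> x * inv_into UNIV \<sigma> y"
    "inv_into UNIV \<sigma> (of_rat q) = of_rat q" for x y q
    by (rule injectivity, simp only: right_inv hom_add hom_mult Gal_of_rat[OF assms])+
  then show ?thesis using \<open>bij \<sigma>\<close> by (auto simp: galois_group_def bij_imp_bij_inv)
qed

lemma group_galois_group: "group (galois_group :: ('a::field_char_0 \<Rightarrow> 'a) monoid)"
proof (rule groupI)
  fix \<sigma> :: "'a \<Rightarrow> 'a" assume "\<sigma> \<in> Gal"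
  then show "\<exists>\<tau>\<in>Gal. \<tau> \<otimes>\<^bsub>galois_group\<^esub> \<sigma> = \<one>\<^bsub>galois_group\<^esub>"
    using Gal_bij by (intro bexI[of _ "inv_into UNIV \<sigma>"] inv_in_Gal) (simp_all add: galois_group_def bij_is_inj)
qed (auto simp: galois_group_def bij_comp comp_assoc)

lemma bij_betw_comp_Gal:
  assumes "\<tau> \<in> Gal"
  shows "bij_betw ((\<circ>) \<tau>) Gal Gal"
proof -
  interpret group galois_group by (rule group_galois_group)
  have "(\<otimes>\<^bsub>galois_group\<^esub>) \<tau> = (\<circ>) \<tau>" by (simp add: galois_group_def)
  then show ?thesis
    using inj_on_cmult[OF assms] surj_const_mult[OF assms] unfolding bij_betw_def by (simp only:)
qed

lemma poly_Gal_rat: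
  assumes "\<sigma> \<in> Gal" and "\<And>i. coeff g i \<in> \<rat>"
  shows "poly g (\<sigma> x) = \<sigma> (poly g x)"
proof -
  interpret field_hom \<sigma> using assms(1) by (rule Gal_field_hom)
  have "\<sigma> (coeff g i) = coeff g i" for i using assms by (rule Gal_Rats)
  then have "map_poly \<sigma> g = g" by (intro poly_eqI) (simp only: coeff_map_poly_hom)
  then show ?thesis using poly_map_poly[of g x] by (simp only:)
qed

lemma algebraic_int_Gal:
  assumes "\<sigma> \<in> Gal" "algebraic_int x"
  shows "algebraic_int (\<sigma> x)"
proof -
  from assms(2) obtain g where g: "lead_coeff g = 1" "\<And>i. coeff g i \<in> \<int>" "poly g x = 0"
    by (auto elim: algebraic_int.cases)
  have "coeff g i \<in> \<rat>" for i using g(2)[of i] Ints_subset_Rats by blast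
  then have "poly g (\<sigma> x) = 0" using poly_Gal_rat[OF assms(1)] g(3) Gal_zero[OF assms(1)] by metis
  then show ?thesis using g(1,2) by (auto intro!: algebraic_int.intros)
qed

definition conjugates :: "'a::field_char_0 \<Rightarrow> 'a set" where
  "conjugates x = (\<lambda>\<sigma>. \<sigma> x) ` Gal"

lemma conjugates_subset_roots:
  assumes "\<And>i. coeff g i \<in> \<rat>" "poly g x = 0"
  shows "conjugates x \<subseteq> {y. poly g y = 0}"
proof
  fix y assume "y \<in> conjugates x"
  then obtain \<sigma> where \<sigma>: "\<sigma> \<in> Gal" "y = \<sigma> x" by (auto simp: conjugates_def)
  then show "y \<in> {y. poly g y = 0}" using assms Gal_zero[of \<sigma>] by (simp add: poly_Gal_rat[of \<sigma>])
qed

abbreviation powers_below :: "nat \<Rightarrow> 'a::field_char_0 \<Rightarrow> 'a set" where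
  "powers_below k x \<equiv> (\<lambda>i. x ^ i) ` {..<k}"

lemma span_powers_imp_poly:
  assumes "y \<in> rat_vs.span (powers_below k x)"
  obtains g where "\<And>i. coeff g i \<in> \<rat>" "\<And>i. i \<ge> k \<Longrightarrow> coeff g i = 0" "poly g x = y"
proof -
  have "\<exists>g. (\<forall>i. coeff g i \<in> \<rat>) \<and> (\<forall>i\<ge>k. coeff g i = 0) \<and> poly g x = y"
    using assms
  proof (induction rule: rat_vs.span_induct_alt)
    case base
    show ?case by (intro exI[of _ 0]) simp
  next
    case (step c v y)
    then obtain g i where "i < k" "v = x ^ i" "\<forall>i. coeff g i \<in> \<rat>" "\<forall>i\<ge>k. coeff g i = 0" "poly g x = y"
      by blast
    then show ?case
      by (intro exI[of _ "monom (of_rat c) i + g"]) (simp add: rat_scale_def poly_monom)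
  qed
  then show ?thesis using that by blast
qed

lemma
  assumes "x ^ k \<in> rat_vs.span (powers_below k x)"
  shows finite_conjugates_if_power_in_span: "finite (conjugates x)"
    and card_conjugates_le_if_power_in_span: "card (conjugates x) \<le> k"
proof -
  obtain g where g: "\<And>i. coeff g i \<in> \<rat>" "\<And>i. i \<ge> k \<Longrightarrow> coeff g i = 0" "poly g x = x ^ k"
    using span_powers_imp_poly[OF assms] by blast
  let ?f = "monom 1 k - g"
  have "coeff ?f k = 1" using g(2) by simp
  then have "?f \<noteq> 0" by auto
  have "conjugates x \<subseteq> {y. poly ?f y = 0}"
    using g(1,3) by (intro conjugates_subset_roots) (simp_all add: poly_monom)
  with poly_roots_finite[OF \<open>?f \<noteq> 0\<close>] show "finite (conjugates x)"
    by (rule finite_subset[rotated])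
  have "card (conjugates x) \<le> card {y. poly ?f y = 0}"
    using \<open>conjugates x \<subseteq> _\<close> by (intro card_mono poly_roots_finite \<open>?f \<noteq> 0\<close>)
  also have "\<dots> \<le> degree ?f" using \<open>?f \<noteq> 0\<close> by (rule card_poly_roots_bound)
  also have "\<dots> \<le> k" using g(2) by (intro degree_le) simp
  finally show "card (conjugates x) \<le> k" .
qed

lemma independent_powers_below:
  assumes "\<And>j. j < k \<Longrightarrow> x ^ j \<notin> rat_vs.span (powers_below j x)"
  shows "rat_vs.independent (powers_below k x) \<and> card (powers_below k x) = k"
  using assms
proof (induction k)
  case (Suc k)
  have lower_powers: "rat_vs.independent (powers_below k x)" "card (powers_below k x) = k"
    using Suc.IH[OF Suc.prems[OF less_SucI]] by blast+
  have new: "x ^ k \<notin> rat_vs.span (powers_below k x)" by (rule Suc.prems) simp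
  then have "x ^ k \<notin> powers_below k x" by (metis rat_vs.span_base)
  then have "card (insert (x ^ k) (powers_below k x)) = Suc k"
    using lower_powers(2) by (subst card_insert_disjoint) simp_all
  then show ?case
    using rat_vs.independent_insertI[OF new lower_powers(1)] unfolding lessThan_Suc image_insert by blast
qed (simp add: rat_vs.independent_empty)

lemma finite_galois_obtain_basis:
  assumes "finite_galois_over_rat TYPE('a::field_char_0)"
  obtains B where "finite_dimensional_vector_space (rat_scale :: rat \<Rightarrow> 'a \<Rightarrow> 'a) B"
proof -
  obtain B\<^sub>0 :: "'a set" where B\<^sub>0: "finite B\<^sub>0" "rat_vs.span B\<^sub>0 = UNIV"
    using assms by (auto simp: finite_galois_over_rat_def)
  obtain B :: "'a set" where B: "rat_vs.independent B" "UNIV \<subseteq> rat_vs.span B"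
    using rat_vs.basis_exists[of UNIV] by metis
  have "finite B" using rat_vs.independent_span_bound[OF B\<^sub>0(1) B(1)] B\<^sub>0(2) by simp
  then have "finite_dimensional_vector_space (rat_scale :: rat \<Rightarrow> 'a \<Rightarrow> 'a) B"
    using B by unfold_locales auto
  then show ?thesis by (rule that)
qed

lemma obtain_least_power_in_span:
  fixes x :: "'a::field_char_0"
  assumes "finite_galois_over_rat TYPE('a)"
  obtains k where "k \<le> degree_over_rat TYPE('a)" "x ^ k \<in> rat_vs.span (powers_below k x)"
    "rat_vs.independent (powers_below k x)" "card (powers_below k x) = k"
proof -
  let ?n = "degree_over_rat TYPE('a)"
  obtain B where "finite_dimensional_vector_space (rat_scale :: rat \<Rightarrow> 'a \<Rightarrow> 'a) B"
    using finite_galois_obtain_basis[OF assms] .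
  then interpret finite_dimensional_vector_space "rat_scale :: rat \<Rightarrow> 'a \<Rightarrow> 'a" B .
  have bound: "k \<le> ?n" if "\<And>j. j < k \<Longrightarrow> x ^ j \<notin> rat_vs.span (powers_below j x)" for k
    using independent_powers_below[OF that] independent_card_le_dim[of "powers_below k x" UNIV]
    unfolding degree_over_rat_def by (metis subset_UNIV)
  let ?in_span = "\<lambda>k. x ^ k \<in> rat_vs.span (powers_below k x)"
  define k where "k = (LEAST k. ?in_span k)"
  have "\<exists>k. ?in_span k"
  proof (rule ccontr)
    assume "\<not> (\<exists>k. ?in_span k)"
    then have "Suc ?n \<le> ?n" by (intro bound) blast
    then show False by simp
  qed
  then have "?in_span k" unfolding k_def by (rule LeastI_ex)
  moreover have minimal: "\<not> ?in_span j" if "j < k" for j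
    using that unfolding k_def by (rule not_less_Least)
  ultimately show ?thesis
    using that bound[OF minimal] independent_powers_below[OF minimal] by blast
qed

lemma span_powers_if_card_conjugates_eq_degree:
  fixes x :: "'a::field_char_0"
  assumes galois: "finite_galois_over_rat TYPE('a)"
    and "card (conjugates x) = degree_over_rat TYPE('a)"
  shows "rat_vs.span (powers_below (degree_over_rat TYPE('a)) x) = UNIV"
proof -
  obtain k where k: "k \<le> degree_over_rat TYPE('a)" "x ^ k \<in> rat_vs.span (powers_below k x)"
      "rat_vs.independent (powers_below k x)" "card (powers_below k x) = k"
    using obtain_least_power_in_span[OF galois] .
  then have k_eq: "k = degree_over_rat TYPE('a)"
    using card_conjugates_le_if_power_in_span[OF k(2)] assms(2) by simp
  obtain B where "finite_dimensional_vector_space (rat_scale :: rat \<Rightarrow> 'a \<Rightarrow> 'a) B"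
    using finite_galois_obtain_basis[OF galois] .
  then interpret finite_dimensional_vector_space "rat_scale :: rat \<Rightarrow> 'a \<Rightarrow> 'a" B .
  have "UNIV \<subseteq> rat_vs.span (powers_below k x)"
    using k(3,4) by (intro card_ge_dim_independent) (simp_all add: k_eq degree_over_rat_def)
  then show ?thesis by (auto simp: k_eq)
qed

lemma inj_on_Gal_if_span_powers:
  assumes "rat_vs.span (powers_below n x) = (UNIV :: 'a::field_char_0 set)"
  shows "inj_on (\<lambda>\<sigma>. \<sigma> x) Gal"
proof (rule inj_onI, rule ext)
  fix \<sigma> \<tau> :: "'a \<Rightarrow> 'a" and y
  assume \<sigma>: "\<sigma> \<in> Gal" and \<tau>: "\<tau> \<in> Gal" and eq: "\<sigma> x = \<tau> x"
  have "rat_vs.subspace {y. \<sigma> y = \<tau> y}"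
    unfolding rat_vs.subspace_def rat_scale_def
    by (simp add: Gal_hom[OF \<sigma>] Gal_hom[OF \<tau>] Gal_of_rat[OF \<sigma>] Gal_of_rat[OF \<tau>])
  moreover have "powers_below n x \<subseteq> {y. \<sigma> y = \<tau> y}"
    using eq by (simp add: image_subset_iff Gal_hom[OF \<sigma>] Gal_hom[OF \<tau>])
  ultimately have "rat_vs.span (powers_below n x) \<subseteq> {y. \<sigma> y = \<tau> y}"
    by (rule rat_vs.span_minimal[rotated])
  moreover have "y \<in> rat_vs.span (powers_below n x)" using assms by simp
  ultimately show "\<sigma> y = \<tau> y" by blast
qed

section \<open>Multiplicative independence\<close>

lemma homogeneous_system_nontrivial_solution:
  fixes f :: "'i \<Rightarrow> 'j \<Rightarrow> 'a::idom"
  assumes "finite I" "finite J" "card J < card I"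
  shows "\<exists>c. (\<exists>i\<in>I. c i \<noteq> 0) \<and> (\<forall>j\<in>J. (\<Sum>i\<in>I. c i * f i j) = 0)"
proof -
  let ?n = "card I" and ?m = "card J"
  obtain b where b: "bij_betw b {0..<?n} I" using ex_bij_betw_nat_finite[OF assms(1)] by blast
  obtain d where d: "bij_betw d {0..<?m} J" using ex_bij_betw_nat_finite[OF assms(2)] by blast
  let ?row = "\<lambda>r. vec ?n (\<lambda>k. f (b k) (d r))"
  define A where "A = mat\<^sub>r ?n ?n (\<lambda>r. if r = ?m then 0\<^sub>v ?n else ?row r)"
  have A: "A \<in> carrier_mat ?n ?n" by (simp add: A_def)
  have "det A = 0" unfolding A_def using assms(3) by (intro det_row_0) auto
  then obtain v where v: "v \<in> carrier_vec ?n" "v \<noteq> 0\<^sub>v ?n" "A *\<^sub>v v = 0\<^sub>v ?n"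
    using det_0_iff_vec_prod_zero[OF A] by blast
  define c where "c i = v $ the_inv_into {0..<?n} b i" for i
  have c: "c (b k) = v $ k" if "k < ?n" for k
    using that b by (simp add: c_def bij_betw_def the_inv_into_f_f)
  obtain k where "k < ?n" "v $ k \<noteq> 0" using v(1,2) by (auto simp: vec_eq_iff)
  then have "\<exists>i\<in>I. c i \<noteq> 0" using c b by (intro bexI[of _ "b k"]) (auto simp: bij_betw_def)
  moreover have "(\<Sum>i\<in>I. c i * f i j) = 0" if "j \<in> J" for j
  proof -
    have "j \<in> d ` {0..<?m}" using that d by (simp add: bij_betw_def)
    then obtain r where r: "r < ?m" "j = d r" by auto
    have "(\<Sum>i\<in>I. c i * f i j) = (\<Sum>k\<in>{0..<?n}. c (b k) * f (b k) j)"
      using sum.reindex_bij_betw[OF b, of "\<lambda>i. c i * f i j"] by simp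
    also have "\<dots> = row A r \<bullet> v"
      using r assms(3) v(1) c by (auto simp: A_def scalar_prod_def mult.commute intro!: sum.cong)
    also have "\<dots> = (A *\<^sub>v v) $ r" using r assms(3) A by simp
    also have "\<dots> = 0" using v(3) r(1) assms(3) by simp
    finally show ?thesis .
  qed
  ultimately show ?thesis by blast
qed

lemma power_int_sum: "(x::'a::field) \<noteq> 0 \<Longrightarrow> x powi sum f A = (\<Prod>i\<in>A. x powi f i)"
  by (induction A rule: infinite_finite_induct) (auto simp: power_int_add)

lemma prod_power_int: "prod f A powi k = (\<Prod>i\<in>A. f i powi k)"
  for f :: "'b \<Rightarrow> 'a::field"
  by (induction A rule: infinite_finite_induct) (auto simp: power_int_mult_distrib)

lemma prod_power_int_exponent_matrix:
  fixes C :: "'a::field set"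
  assumes "0 \<notin> C"
  shows "(\<Prod>s\<in>S. (\<Prod>c\<in>C. c powi M s c) powi e s) = (\<Prod>c\<in>C. c powi (\<Sum>s\<in>S. e s * M s c))"
proof -
  have "(\<Prod>s\<in>S. (\<Prod>c\<in>C. c powi M s c) powi e s) = (\<Prod>s\<in>S. \<Prod>c\<in>C. c powi (e s * M s c))"
    by (simp add: prod_power_int power_int_mult[symmetric] mult.commute)
  also have "\<dots> = (\<Prod>c\<in>C. \<Prod>s\<in>S. c powi (e s * M s c))" by (rule prod.swap)
  also have "\<dots> = (\<Prod>c\<in>C. c powi (\<Sum>s\<in>S. e s * M s c))"
    using assms by (intro prod.cong refl power_int_sum[symmetric]) auto
  finally show ?thesis .
qed

lemma group_mult_group: "group (mult_group :: 'a::field_char_0 monoid)"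
  by (rule groupI) (auto simp: mult_group_def intro!: bexI[of _ "inverse _"])

lemma generate_mult_group_exponents:
  assumes "finite C" "0 \<notin> C" "s \<in> generate mult_group C"
  shows "\<exists>e. s = (\<Prod>c\<in>C. c powi e c)"
  using assms(3)
proof (induction rule: generate.induct)
  case one
  show ?case by (intro exI[of _ "\<lambda>_. 0"]) (simp add: mult_group_def)
next
  case (incl x)
  have "(\<Prod>c\<in>C. c powi of_bool (c = x)) = (\<Prod>c\<in>C. if c = x then c else 1)"
    by (intro prod.cong) auto
  then show ?case using incl assms by (intro exI[of _ "\<lambda>c. of_bool (c = x)"]) simp
next
  case (inv x)
  interpret group mult_group by (rule group_mult_group)
  have "x \<noteq> 0" using inv assms by auto
  then have "inv\<^bsub>mult_group\<^esub> x = inverse x"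
    by (intro inv_equality) (auto simp: mult_group_def)
  moreover have "(\<Prod>c\<in>C. c powi (- of_bool (c = x))) = (\<Prod>c\<in>C. if c = x then inverse c else 1)"
    by (intro prod.cong) (auto simp: power_int_minus)
  ultimately show ?case using inv assms by (intro exI[of _ "\<lambda>c. - of_bool (c = x)"]) simp
next
  case (eng x y)
  then obtain e e' where "x = (\<Prod>c\<in>C. c powi e c)" "y = (\<Prod>c\<in>C. c powi e' c)" by blast
  moreover have "(\<Prod>c\<in>C. c powi e c) * (\<Prod>c\<in>C. c powi e' c) = (\<Prod>c\<in>C. c powi (e c + e' c))"
    using assms(2) unfolding prod.distrib[symmetric]
    by (intro prod.cong refl power_int_add[symmetric]) auto
  ultimately show ?case by (intro exI[of _ "\<lambda>c. e c + e' c"]) (simp add: mult_group_def)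
qed

lemma exponent_matrix_exists:
  assumes "finite C" "0 \<notin> C" "S \<subseteq> generate mult_group C"
  shows "\<exists>M. \<forall>e. (\<Prod>s\<in>S. s powi e s) = (\<Prod>c\<in>C. c powi (\<Sum>s\<in>S. e s * M s c))"
proof -
  have "\<forall>s\<in>S. \<exists>e. s = (\<Prod>c\<in>C. c powi e c)"
    using generate_mult_group_exponents[OF assms(1,2)] assms(3) by blast
  then obtain M where M: "\<forall>s\<in>S. s = (\<Prod>c\<in>C. c powi M s c)" by metis
  have "(\<Prod>s\<in>S. s powi e s) = (\<Prod>c\<in>C. c powi (\<Sum>s\<in>S. e s * M s c))" for e
  proof -
    have "(\<Prod>s\<in>S. s powi e s) = (\<Prod>s\<in>S. (\<Prod>c\<in>C. c powi M s c) powi e s)"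
      using M by (intro prod.cong) auto
    also have "\<dots> = (\<Prod>c\<in>C. c powi (\<Sum>s\<in>S. e s * M s c))"
      by (rule prod_power_int_exponent_matrix[OF assms(2)])
    finally show ?thesis .
  qed
  then show ?thesis by blast
qed

lemma mult_independent_finite: "mult_independent S \<Longrightarrow> finite S"
  by (simp add: mult_independent_def)

lemma mult_independentD:
  assumes "mult_independent S" "(\<Prod>s\<in>S. s powi e s) = 1" "s \<in> S"
  shows "e s = 0"
  using assms unfolding mult_independent_def by (elim conjE allE[of _ e]) simp

lemma mult_independent_card_le_generators:
  assumes C: "finite C" "0 \<notin> C" and S: "S \<subseteq> generate mult_group C" "mult_independent S"
  shows "card S \<le> card C"
proof (rule ccontr)
  assume "\<not> card S \<le> card C"
  obtain M where M: "\<forall>e. (\<Prod>s\<in>S. s powi e s) = (\<Prod>c\<in>C. c powi (\<Sum>s\<in>S. e s * M s c))"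
    using exponent_matrix_exists[OF C S(1)] by (rule exE)
  have "card C < card S" using \<open>\<not> card S \<le> card C\<close> by simp
  from homogeneous_system_nontrivial_solution[OF mult_independent_finite[OF S(2)] C(1) this, of M]
  obtain e where e: "\<exists>s\<in>S. e s \<noteq> 0" "\<forall>c\<in>C. (\<Sum>s\<in>S. e s * M s c) = 0"
    by (elim exE conjE)
  then have "(\<Prod>s\<in>S. s powi e s) = 1" using M by simp
  then show False using e(1) mult_independentD[OF S(2), of e] by simp
qed

text \<open>
  The exponent vectors of \<open>S\<close> and of a relation among \<open>C\<close> are more than \<open>card C\<close> integer vectors of
  length \<open>card C\<close>, hence linearly dependent.
\<close>

lemma mult_independent_generators:
  assumes C: "finite C" "0 \<notin> C" and S: "S \<subseteq> generate mult_group C" "mult_independent S"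
    and "card C \<le> card S"
  shows "mult_independent C"
  unfolding mult_independent_def
proof (intro conjI C(1) allI impI ballI)
  fix u :: "'a \<Rightarrow> int" and x
  assume u: "(\<Prod>c\<in>C. c powi u c) = 1" and x: "x \<in> C"
  obtain M where M: "\<forall>e. (\<Prod>s\<in>S. s powi e s) = (\<Prod>c\<in>C. c powi (\<Sum>s\<in>S. e s * M s c))"
    using exponent_matrix_exists[OF C S(1)] by (rule exE)
  let ?I = "insert None (Some ` S)"
  let ?f = "\<lambda>i. case i of None \<Rightarrow> u | Some s \<Rightarrow> M s"
  have "finite S" using S(2) by (rule mult_independent_finite)
  then have I: "finite ?I" "card C < card ?I"
    using assms(5) by (simp_all add: card_image card_insert_if image_iff)
  obtain e where e: "\<exists>i\<in>?I. e i \<noteq> 0" "\<forall>c\<in>C. (\<Sum>i\<in>?I. e i * ?f i c) = 0"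
    using homogeneous_system_nontrivial_solution[OF I(1) C(1) I(2), of ?f] by (elim exE conjE)
  have relation: "(\<Sum>s\<in>S. e (Some s) * M s c) = u c * - e None" if "c \<in> C" for c
    using bspec[OF e(2) that] \<open>finite S\<close>
    by (simp add: sum.reindex image_iff eq_neg_iff_add_eq_0 algebra_simps)
  have "(\<Prod>s\<in>S. s powi e (Some s)) = (\<Prod>c\<in>C. (c powi u c) powi (- e None))"
    unfolding M[rule_format] using relation by (intro prod.cong refl) (simp only: power_int_mult)
  also have "\<dots> = 1" by (simp flip: prod_power_int add: u)
  finally have "e (Some s) = 0" if "s \<in> S" for s
    using that mult_independentD[OF S(2), of "\<lambda>s. e (Some s)"] by blast
  then have "e None \<noteq> 0" "u x * - e None = 0" using e(1) relation[OF x] by auto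
  then show "u x = 0" by simp
qed

lemma mult_independent_conjugates:
  fixes \<eta> :: "'a::field_char_0"
  assumes galois: "finite_galois_over_rat TYPE('a)" and "\<eta> \<noteq> 0"
    and rank: "has_mult_rank (galois_module \<eta>) (degree_over_rat TYPE('a))"
  shows "mult_independent (conjugates \<eta>)" "card (conjugates \<eta>) = degree_over_rat TYPE('a)"
proof -
  obtain k where k: "k \<le> degree_over_rat TYPE('a)" "\<eta> ^ k \<in> rat_vs.span (powers_below k \<eta>)"
    using obtain_least_power_in_span[OF galois] by metis
  have finite: "finite (conjugates \<eta>)" and card: "card (conjugates \<eta>) \<le> degree_over_rat TYPE('a)"
    using finite_conjugates_if_power_in_span[OF k(2)] card_conjugates_le_if_power_in_span[OF k(2)] k(1) by simp_all
  have nonzero: "0 \<notin> conjugates \<eta>"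
  proof
    assume "0 \<in> conjugates \<eta>"
    then obtain \<sigma> where "\<sigma> \<in> Gal" "\<sigma> \<eta> = 0" by (auto simp: conjugates_def)
    then show False using assms(2) by (simp only: Gal_eq_zero_iff)
  qed
  obtain S where S: "S \<subseteq> generate mult_group (conjugates \<eta>)" "mult_independent S"
      "card S = degree_over_rat TYPE('a)"
    using rank by (auto simp: has_mult_rank_def galois_module_def conjugates_def)
  show "mult_independent (conjugates \<eta>)"
    using card S(3) by (intro mult_independent_generators[OF finite nonzero S(1,2)]) simp
  show "card (conjugates \<eta>) = degree_over_rat TYPE('a)"
    using card S(3) mult_independent_card_le_generators[OF finite nonzero S(1,2)] by simp
qed

section \<open>Congruences between p-integral elements\<close>

lemma p_integers_ops [simp]:
  "x \<oplus>\<^bsub>p_integers p\<^esub> y = x + y" "x \<otimes>\<^bsub>p_integers p\<^esub> y = x * y" "\<zero>\<^bsub>p_integers p\<^esub> = 0" "\<one>\<^bsub>p_integers p\<^esub> = 1"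
  by (simp_all add: p_integers_def)

locale rational_prime =
  fixes p :: nat
  assumes prime_p: "Factorial_Ring.prime p"
begin

abbreviation p_integral :: "'a::field_char_0 set" where
  "p_integral \<equiv> carrier (p_integers p)"

definition localization :: "'a::field_char_0 set \<Rightarrow> 'a set" where
  "localization A = {x. \<exists>m. \<not> int p dvd m \<and> of_int m * x \<in> A}"

lemma prime_int_p: "Factorial_Ring.prime (int p)"
  using prime_p by simp

lemma p_pos: "p > 0"
  using prime_p by (rule prime_gt_0_nat)

lemma not_dvd_mult: "\<not> int p dvd m \<Longrightarrow> \<not> int p dvd k \<Longrightarrow> \<not> int p dvd m * k"
  using prime_int_p by (simp add: prime_dvd_mult_iff)

lemma localization_base: "x \<in> A \<Longrightarrow> x \<in> localization A"
  using prime_int_p not_prime_unit[of "int p"] by (auto simp: localization_def intro!: exI[of _ 1])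

lemma localization_add:
  assumes "\<And>a b. a \<in> A \<Longrightarrow> b \<in> A \<Longrightarrow> a + b \<in> A" and "\<And>(m::int) a. a \<in> A \<Longrightarrow> of_int m * a \<in> A"
    and "x \<in> localization A" "y \<in> localization A"
  shows "x + y \<in> localization A"
proof -
  obtain m k where m: "\<not> int p dvd m" "of_int m * x \<in> A" and k: "\<not> int p dvd k" "of_int k * y \<in> A"
    using assms(3,4) by (auto simp: localization_def)
  have "of_int k * (of_int m * x) + of_int m * (of_int k * y) \<in> A"
    using assms(2)[OF m(2)] assms(2)[OF k(2)] by (rule assms(1))
  also have "of_int k * (of_int m * x) + of_int m * (of_int k * y) = of_int (m * k) * (x + y)"
    by (simp add: algebra_simps)
  finally have "of_int (m * k) * (x + y) \<in> A" .
  then show ?thesis using not_dvd_mult[OF m(1) k(1)] unfolding localization_def by blast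
qed

lemma localization_mult:
  assumes "\<And>a b. a \<in> A \<Longrightarrow> b \<in> B \<Longrightarrow> a * b \<in> C"
    and "x \<in> localization A" "y \<in> localization B"
  shows "x * y \<in> localization C"
proof -
  obtain m k where m: "\<not> int p dvd m" "of_int m * x \<in> A" and k: "\<not> int p dvd k" "of_int k * y \<in> B"
    using assms(2,3) by (auto simp: localization_def)
  have "of_int (m * k) * (x * y) \<in> C" using assms(1)[OF m(2) k(2)] by (simp add: mult_ac)
  then show ?thesis using not_dvd_mult[OF m(1) k(1)] unfolding localization_def by blast
qed

lemma p_integral_eq_localization: "p_integral = localization {x :: 'a::field_char_0. algebraic_int x}"
proof -
  have "x = a / of_int m \<longleftrightarrow> of_int m * x = a" if "\<not> int p dvd m" for x a :: 'a and m
    using that by (auto simp: field_simps)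
  then have "x \<in> p_integral \<longleftrightarrow> (\<exists>m. \<not> int p dvd m \<and> algebraic_int (of_int m * x))" for x :: 'a
    by (simp add: p_integers_def ring_of_integers_def) metis
  then show ?thesis by (auto simp: localization_def)
qed

lemma p_integralE:
  assumes "x \<in> p_integral"
  obtains m where "\<not> int p dvd m" "algebraic_int (of_int m * x)"
  using assms by (auto simp: p_integral_eq_localization localization_def)

lemma algebraic_int_p_integral: "algebraic_int x \<Longrightarrow> x \<in> p_integral"
  by (simp add: p_integral_eq_localization localization_base)

lemma p_integral_of_int [simp]: "of_int k \<in> p_integral"
  by (simp add: algebraic_int_p_integral int_imp_algebraic_int)

lemma p_integral_of_nat [simp]: "of_nat k \<in> p_integral"
  using p_integral_of_int[of "int k"] by simp

lemma p_integral_0 [simp]: "0 \<in> p_integral" and p_integral_1 [simp]: "1 \<in> p_integral"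
  using p_integral_of_int[of 0] p_integral_of_int[of 1] by simp_all

lemma p_integral_add [simp]: "x \<in> p_integral \<Longrightarrow> y \<in> p_integral \<Longrightarrow> x + y \<in> p_integral"
  unfolding p_integral_eq_localization
  by (rule localization_add) (auto intro: algebraic_int_add algebraic_int_mult int_imp_algebraic_int)

lemma p_integral_mult [simp]: "x \<in> p_integral \<Longrightarrow> y \<in> p_integral \<Longrightarrow> x * y \<in> p_integral"
  unfolding p_integral_eq_localization by (rule localization_mult) (auto intro: algebraic_int_mult)

lemma p_integral_uminus [simp]: "x \<in> p_integral \<Longrightarrow> - x \<in> p_integral"
  using p_integral_mult[of "of_int (-1)" x] p_integral_of_int[of "-1"] by simp

lemma p_integral_diff [simp]: "x \<in> p_integral \<Longrightarrow> y \<in> p_integral \<Longrightarrow> x - y \<in> p_integral"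
  using p_integral_add[of x "- y"] by simp

lemma p_integral_power [simp]: "x \<in> p_integral \<Longrightarrow> x ^ k \<in> p_integral"
  by (induction k) auto

lemma p_integral_sum [simp]: "(\<And>i. i \<in> A \<Longrightarrow> f i \<in> p_integral) \<Longrightarrow> sum f A \<in> p_integral"
  by (induction A rule: infinite_finite_induct) auto

lemma p_integral_prod [simp]: "(\<And>i. i \<in> A \<Longrightarrow> f i \<in> p_integral) \<Longrightarrow> prod f A \<in> p_integral"
  by (induction A rule: infinite_finite_induct) auto

lemma p_integral_Gal: "\<sigma> \<in> Gal \<Longrightarrow> x \<in> p_integral \<Longrightarrow> \<sigma> x \<in> p_integral"
proof (elim p_integralE)
  fix m assume \<sigma>: "\<sigma> \<in> Gal" and m: "\<not> int p dvd m" "algebraic_int (of_int m * x)"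
  have "algebraic_int (of_int m * \<sigma> x)"
    using algebraic_int_Gal[OF \<sigma> m(2)] by (simp add: Gal_hom[OF \<sigma>])
  then show "\<sigma> x \<in> p_integral"
    using m(1) by (auto simp: p_integral_eq_localization localization_def)
qed

lemma p_integral_poly:
  "(\<And>i. coeff g i \<in> p_integral) \<Longrightarrow> x \<in> p_integral \<Longrightarrow> poly g x \<in> p_integral"
  by (simp add: poly_altdef)

lemma cring_p_integers: "cring (p_integers p :: 'a::field_char_0 ring)"
proof (rule cringI)
  show "abelian_group (p_integers p :: 'a ring)"
  proof (rule abelian_groupI)
    fix x :: 'a assume "x \<in> p_integral"
    then show "\<exists>y\<in>p_integral. y \<oplus>\<^bsub>p_integers p\<^esub> x = \<zero>\<^bsub>p_integers p\<^esub>"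
      by (intro bexI[of _ "- x"]) simp_all
  qed (simp_all add: add.assoc add.commute)
  show "comm_monoid (p_integers p :: 'a ring)"
    by (rule comm_monoidI) (simp_all add: mult.assoc mult.commute)
qed (simp add: distrib_right)

lemma ideal_p_integersI:
  fixes I :: "'a::field_char_0 set"
  assumes "I \<subseteq> p_integral" "0 \<in> I"
    and "\<And>x y. x \<in> I \<Longrightarrow> y \<in> I \<Longrightarrow> x + y \<in> I" "\<And>r x. r \<in> p_integral \<Longrightarrow> x \<in> I \<Longrightarrow> r * x \<in> I"
  shows "ideal I (p_integers p)"
proof (rule idealI)
  interpret cring "p_integers p :: 'a ring" by (rule cring_p_integers)
  show "ring (p_integers p :: 'a ring)" ..
  show "subgroup I (add_monoid (p_integers p))"
  proof (rule add.subgroupI)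
    fix x assume x: "x \<in> I"
    then have "- x \<in> I" using assms(4)[of "- 1" x] by simp
    moreover have "\<ominus>\<^bsub>p_integers p\<^esub> x = - x"
      using assms(1) x by (intro minus_equality) auto
    ultimately show "\<ominus>\<^bsub>p_integers p\<^esub> x \<in> I" by simp
  qed (use assms in auto)
  fix a x :: 'a assume "a \<in> I" "x \<in> p_integral"
  then have "x * a \<in> I" by (intro assms(4))
  then show "x \<otimes>\<^bsub>p_integers p\<^esub> a \<in> I" "a \<otimes>\<^bsub>p_integers p\<^esub> x \<in> I" by (simp_all add: mult.commute)
qed

end

locale p_congruence = rational_prime +
  fixes S :: "'a::field_char_0 set"
  assumes S_p_integral: "S \<subseteq> p_integral"
begin

abbreviation congruence_ideal :: "'a set" where
  "congruence_ideal \<equiv> Idl\<^bsub>p_integers p\<^esub> S"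

lemma ideal_congruence_ideal: "ideal congruence_ideal (p_integers p)"
  using cring.axioms(1)[OF cring_p_integers] S_p_integral by (rule ring.genideal_ideal)

lemma congruence_ideal_0: "0 \<in> congruence_ideal"
  and congruence_ideal_add: "x \<in> congruence_ideal \<Longrightarrow> y \<in> congruence_ideal \<Longrightarrow> x + y \<in> congruence_ideal"
  and congruence_ideal_mult: "r \<in> p_integral \<Longrightarrow> x \<in> congruence_ideal \<Longrightarrow> r * x \<in> congruence_ideal"
proof -
  interpret ideal congruence_ideal "p_integers p" by (rule ideal_congruence_ideal)
  show "0 \<in> congruence_ideal"
    using additive_subgroup.zero_closed[OF is_additive_subgroup] by simp
  show "x + y \<in> congruence_ideal" if "x \<in> congruence_ideal" "y \<in> congruence_ideal"
    using additive_subgroup.a_closed[OF is_additive_subgroup that] by simp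
  show "r * x \<in> congruence_ideal" if "r \<in> p_integral" "x \<in> congruence_ideal"
    using I_l_closed[OF that(2,1)] by simp
qed

lemma p_cong_p_integral: "p_cong p S x y \<Longrightarrow> x \<in> p_integral" "p_cong p S x y \<Longrightarrow> y \<in> p_integral"
  by (simp_all add: p_cong_def)

lemma p_cong_refl [simp]: "p_cong p S x x \<longleftrightarrow> x \<in> p_integral"
  by (simp add: p_cong_def congruence_ideal_0)

lemma p_cong_sym: "p_cong p S x y \<Longrightarrow> p_cong p S y x"
  using congruence_ideal_mult[of "- 1" "x - y"] by (simp add: p_cong_def)

lemma p_cong_trans [trans]: "p_cong p S x y \<Longrightarrow> p_cong p S y z \<Longrightarrow> p_cong p S x z"
  using congruence_ideal_add[of "x - y" "y - z"] by (simp add: p_cong_def)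

lemma p_cong_add: "p_cong p S x y \<Longrightarrow> p_cong p S x' y' \<Longrightarrow> p_cong p S (x + x') (y + y')"
  using congruence_ideal_add[of "x - y" "x' - y'"] by (simp add: p_cong_def add_diff_add)

lemma p_cong_mult:
  assumes "p_cong p S x y" "p_cong p S x' y'"
  shows "p_cong p S (x * x') (y * y')"
proof -
  have "x' * (x - y) + y * (x' - y') \<in> congruence_ideal"
    using assms by (intro congruence_ideal_add congruence_ideal_mult) (simp_all add: p_cong_def)
  then show ?thesis using assms by (simp add: p_cong_def algebra_simps)
qed

lemma p_cong_mult_right: "r \<in> p_integral \<Longrightarrow> p_cong p S x y \<Longrightarrow> p_cong p S (x * r) (y * r)"
  by (rule p_cong_mult) simp_all

lemma p_cong_iff_diff: "x \<in> p_integral \<Longrightarrow> y \<in> p_integral \<Longrightarrow> p_cong p S x y \<longleftrightarrow> p_cong p S (x - y) 0"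
  by (simp add: p_cong_def)

lemma p_cong_power: "p_cong p S x y \<Longrightarrow> p_cong p S (x ^ k) (y ^ k)"
  by (induction k) (simp_all add: p_cong_mult)

lemma p_cong_sum: "(\<And>i. i \<in> A \<Longrightarrow> p_cong p S (f i) (g i)) \<Longrightarrow> p_cong p S (sum f A) (sum g A)"
  by (induction A rule: infinite_finite_induct) (simp_all add: p_cong_add)

lemma p_cong_prod: "(\<And>i. i \<in> A \<Longrightarrow> p_cong p S (f i) (g i)) \<Longrightarrow> p_cong p S (prod f A) (prod g A)"
  by (induction A rule: infinite_finite_induct) (simp_all add: p_cong_mult)

lemma p_cong_poly:
  "(\<And>i. coeff g i \<in> p_integral) \<Longrightarrow> p_cong p S x y \<Longrightarrow> p_cong p S (poly g x) (poly g y)"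
proof (induction g)
  case (pCons a g)
  have "a \<in> p_integral" "coeff g i \<in> p_integral" for i
    using pCons.prems(1)[of 0] pCons.prems(1)[of "Suc i"] by simp_all
  then show ?case using pCons.IH pCons.prems(2) by (simp add: p_cong_add p_cong_mult)
qed simp

lemma p_cong_inverse:
  assumes "p_cong p S x y" "x \<noteq> 0" "y \<noteq> 0" "inverse x \<in> p_integral" "inverse y \<in> p_integral"
  shows "p_cong p S (inverse x) (inverse y)"
proof -
  have "p_cong p S (y * (inverse x * inverse y)) (x * (inverse x * inverse y))"
    using p_cong_sym[OF assms(1)] assms(4,5) by (intro p_cong_mult_right) simp_all
  moreover have "y * (inverse x * inverse y) = inverse x" "x * (inverse x * inverse y) = inverse y"
    using assms(2,3) by simp_all
  ultimately show ?thesis by simp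
qed

lemma p_cong_power_int:
  assumes "p_cong p S x y" "x \<noteq> 0" "y \<noteq> 0" "inverse x \<in> p_integral" "inverse y \<in> p_integral"
  shows "p_cong p S (x powi k) (y powi k)"
  using p_cong_power[OF assms(1)] p_cong_power[OF p_cong_inverse[OF assms]]
  by (simp add: power_int_def power_inverse)

lemma p_cong_mono:
  assumes "p_cong p T x y" "T \<subseteq> S"
  shows "p_cong p S x y"
proof -
  interpret cring "p_integers p :: 'a ring" by (rule cring_p_integers)
  have "Idl\<^bsub>p_integers p\<^esub> T \<subseteq> congruence_ideal"
    using assms(2) genideal_self[OF S_p_integral] by (intro genideal_minimal ideal_congruence_ideal) blast
  then show ?thesis using assms(1) by (auto simp: p_cong_def)
qed

end

sublocale rational_prime \<subseteq> mod_p: p_congruence p "{of_nat p :: 'a::field_char_0}"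
  by unfold_locales simp

context rational_prime
begin

lemma p_cong_p_iff:
  fixes x y :: "'a::field_char_0"
  shows "p_cong p {of_nat p} x y \<longleftrightarrow>
    x \<in> p_integral \<and> y \<in> p_integral \<and> (\<exists>z\<in>p_integral. x - y = of_nat p * z)"
proof -
  have "Idl\<^bsub>p_integers p\<^esub> {of_nat p} = PIdl\<^bsub>p_integers p\<^esub> (of_nat p :: 'a)"
    by (rule cring.cgenideal_eq_genideal[OF cring_p_integers, symmetric]) simp
  then show ?thesis by (auto simp: p_cong_def cgenideal_def mult.commute)
qed

lemma p_cong_of_int_iff: "p_cong p {of_nat p} (of_int a :: 'a::field_char_0) (of_int b) \<longleftrightarrow> [a = b] (mod int p)"
proof
  assume "p_cong p {of_nat p} (of_int a :: 'a) (of_int b)"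
  then obtain z :: 'a where z: "of_int a - of_int b = of_nat p * z" "z \<in> p_integral"
    by (auto simp: p_cong_p_iff)
  from z(2) obtain m where m: "\<not> int p dvd m" "algebraic_int (of_int m * z)" by (rule p_integralE)
  have "z = of_int (a - b) / of_int (int p)" using z(1) p_pos by (simp add: field_simps)
  then have "of_int m * z \<in> \<rat>" by simp
  with m(2) obtain j where j: "of_int m * z = of_int j"
    using rational_algebraic_int_is_int by (metis Ints_cases)
  have "(of_int (m * (a - b)) :: 'a) = of_int m * (of_nat p * z)" using z(1) by simp
  also have "\<dots> = of_int (int p * j)" by (simp add: mult.left_commute j)
  finally have "m * (a - b) = int p * j" by (simp only: of_int_eq_iff)
  then have "int p dvd m * (a - b)" by simp
  then show "[a = b] (mod int p)"
    using m(1) prime_int_p by (simp add: prime_dvd_mult_iff cong_iff_dvd_diff)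
next
  assume "[a = b] (mod int p)"
  then obtain k where "a - b = int p * k" by (auto simp: cong_iff_dvd_diff)
  then have "of_int a - of_int b = (of_nat p * of_int k :: 'a)"
    by (metis of_int_diff of_int_mult of_int_of_nat_eq)
  then show "p_cong p {of_nat p} (of_int a :: 'a) (of_int b)" by (auto simp: p_cong_p_iff)
qed

lemma p_integral_obtain_algebraic_int_multiple:
  assumes "x \<in> p_integral"
  obtains m :: int where "algebraic_int (of_int m * x)" "p_cong p {of_nat p} x (of_int m * x)"
proof -
  from assms obtain m where m: "\<not> int p dvd m" "algebraic_int (of_int m * x)" by (rule p_integralE)
  have "coprime m (int p)"
    using m(1) prime_int_p by (metis coprime_commute prime_imp_coprime)
  then obtain k where "[m * k = 1] (mod int p)" using cong_solve_coprime_int by blast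
  then have "p_cong p {of_nat p} (1 :: 'a) (of_int (m * k))"
    using p_cong_of_int_iff[of 1 "m * k"] by (simp add: cong_sym_eq)
  then have "p_cong p {of_nat p} x (of_int (m * k) * x)"
    using mod_p.p_cong_mult_right[OF assms] by fastforce
  moreover have "algebraic_int (of_int (m * k) * x)"
    using algebraic_int_mult[OF _ m(2), of "of_int k"] by (simp add: int_imp_algebraic_int mult_ac)
  ultimately show ?thesis using that by blast
qed

lemma Rats_obtain_int_residue:
  assumes "x \<in> p_integral" "x \<in> \<rat>"
  obtains c where "c \<in> {0..<int p}" "p_cong p {of_nat p} x (of_int c)"
proof -
  obtain m where m: "algebraic_int (of_int m * x)" "p_cong p {of_nat p} x (of_int m * x)"
    using p_integral_obtain_algebraic_int_multiple[OF assms(1)] .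
  have "of_int m * x \<in> \<rat>" using assms(2) by simp
  then obtain k where k: "of_int m * x = of_int k"
    using rational_algebraic_int_is_int[OF m(1)] by (metis Ints_cases)
  note m(2)
  also have "p_cong p {of_nat p} (of_int m * x) (of_int (k mod int p))"
    unfolding k p_cong_of_int_iff by (simp add: cong_def)
  finally show ?thesis using that[of "k mod int p"] p_pos by simp
qed

lemma p_cong_Rats_fermat:
  assumes "x \<in> p_integral" "x \<in> \<rat>"
  shows "p_cong p {of_nat p} (x ^ p) x"
proof -
  from assms obtain c where c: "c \<in> {0..<int p}" "p_cong p {of_nat p} x (of_int c)"
    by (rule Rats_obtain_int_residue)
  then obtain k where k: "c = int k" by (metis atLeastLessThan_iff nonneg_int_cases)
  have "[k ^ p = k] (mod p)"
  proof (cases "p dvd k")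
    case True
    then have "p dvd k ^ p" using p_pos by (simp add: dvd_power_le prime_dvd_power_iff prime_p)
    with True show ?thesis by (simp add: cong_def)
  next
    case False
    have "[k ^ (p - 1) * k = 1 * k] (mod p)"
      using fermat_theorem[OF prime_p False] by (rule cong_scalar_right)
    then show ?thesis using p_pos by (simp flip: power_Suc2)
  qed
  then have "[c ^ p = c] (mod int p)" unfolding k using cong_int_iff[of "k ^ p" k p] by simp
  then have "p_cong p {of_nat p} (of_int c ^ p :: 'a) (of_int c)"
    using p_cong_of_int_iff[of "c ^ p" c] by simp
  with mod_p.p_cong_power[OF c(2)] have "p_cong p {of_nat p} (x ^ p) (of_int c)"
    by (rule mod_p.p_cong_trans)
  also have "p_cong p {of_nat p} (of_int c) x" using c(2) by (rule mod_p.p_cong_sym)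
  finally show ?thesis .
qed

lemma p_cong_freshmans_dream:
  assumes "x \<in> p_integral" "y \<in> p_integral"
  shows "p_cong p {of_nat p} ((x + y) ^ p) (x ^ p + y ^ p)"
proof -
  let ?t = "\<lambda>k. of_nat (p choose k) * x ^ k * y ^ (p - k)"
  have "{..p} = insert 0 (insert p {0<..<p})" using p_pos by auto
  then have "(x + y) ^ p = x ^ p + y ^ p + (\<Sum>k\<in>{0<..<p}. ?t k)"
    using p_pos by (simp add: binomial_ring)
  also have "p_cong p {of_nat p} \<dots> (x ^ p + y ^ p + (\<Sum>k\<in>{0<..<p}. 0))"
  proof (intro mod_p.p_cong_add mod_p.p_cong_sum)
    fix k assume "k \<in> {0<..<p}"
    then have "p dvd (p choose k)" using prime_p by (intro dvd_choose_prime) auto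
    then obtain j where "p choose k = p * j" by (elim dvdE)
    then have "?t k - 0 = of_nat p * (of_nat j * x ^ k * y ^ (p - k))" by (simp add: mult_ac)
    moreover have "of_nat j * x ^ k * y ^ (p - k) \<in> p_integral" "?t k \<in> p_integral"
      using assms by simp_all
    ultimately show "p_cong p {of_nat p} (?t k) 0" unfolding p_cong_p_iff using p_integral_0 by blast
  qed (use assms in simp_all)
  finally show ?thesis by simp
qed

lemma p_cong_poly_frobenius:
  assumes "\<And>i. coeff g i \<in> p_integral" "\<And>i. coeff g i \<in> \<rat>" "x \<in> p_integral"
  shows "p_cong p {of_nat p} (poly g x ^ p) (poly g (x ^ p))"
  using assms(1,2)
proof (induction g)
  case 0
  then show ?case using p_pos by (simp add: zero_power)
next
  case (pCons a g)
  have g: "coeff g i \<in> p_integral" "coeff g i \<in> \<rat>" for i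
    using pCons.prems(1)[of "Suc i"] pCons.prems(2)[of "Suc i"] by simp_all
  have a: "a \<in> p_integral" "a \<in> \<rat>" using pCons.prems(1)[of 0] pCons.prems(2)[of 0] by simp_all
  have "p_cong p {of_nat p} ((a + x * poly g x) ^ p) (a ^ p + (x * poly g x) ^ p)"
    using a(1) assms(3) p_integral_poly[OF g(1) assms(3)] by (intro p_cong_freshmans_dream) simp_all
  also have "p_cong p {of_nat p} (a ^ p + (x * poly g x) ^ p) (a + x ^ p * poly g (x ^ p))"
    unfolding power_mult_distrib
    using a pCons.IH[OF g] assms(3)
    by (intro mod_p.p_cong_add mod_p.p_cong_mult p_cong_Rats_fermat) simp_all
  finally show ?case by simp
qed

end

section \<open>Prime ideals above p and their residue fields\<close>

locale prime_above = rational_prime +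
  fixes P :: "'a::field_char_0 set"
  assumes P_above: "P \<in> primes_above p"
begin

abbreviation residue_field :: "'a set ring" where
  "residue_field \<equiv> ring_of_integers Quot P"

lemma primeideal_P: "primeideal P ring_of_integers"
  and p_in_P: "of_nat p \<in> P"
  using P_above by (auto simp: primes_above_def)

lemma P_algebraic_int: "x \<in> P \<Longrightarrow> algebraic_int x"
  and P_add: "x \<in> P \<Longrightarrow> y \<in> P \<Longrightarrow> x + y \<in> P"
  and P_mult: "algebraic_int r \<Longrightarrow> x \<in> P \<Longrightarrow> r * x \<in> P"
  and P_prime: "algebraic_int x \<Longrightarrow> algebraic_int y \<Longrightarrow> x * y \<in> P \<Longrightarrow> x \<in> P \<or> y \<in> P"
proof -
  interpret primeideal P ring_of_integers by (rule primeideal_P)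
  show "algebraic_int x" if "x \<in> P" using a_subset that by auto
  show "x + y \<in> P" if "x \<in> P" "y \<in> P"
    using additive_subgroup.a_closed[OF is_additive_subgroup that] by simp
  show "r * x \<in> P" if "algebraic_int r" "x \<in> P" using I_l_closed[OF that(2), of r] that(1) by simp
  show "x \<in> P \<or> y \<in> P" if "algebraic_int x" "algebraic_int y" "x * y \<in> P"
    using I_prime[of x y] that by simp
qed

lemma one_notin_P: "1 \<notin> P"
proof
  assume "1 \<in> P"
  then have "carrier ring_of_integers = P"
    using P_mult[of _ 1] P_algebraic_int by auto
  then show False using primeideal.I_notcarr[OF primeideal_P] by simp
qed

lemma of_int_in_P_iff: "of_int k \<in> P \<longleftrightarrow> int p dvd k"
proof
  assume k: "of_int k \<in> P"
  show "int p dvd k"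
  proof (rule ccontr)
    assume "\<not> int p dvd k"
    then have "coprime (int p) k" using prime_int_p by (intro prime_imp_coprime)
    then obtain u v where "u * int p + v * k = 1" by (metis bezout_int coprime_iff_gcd_eq_1)
    then have "of_int u * of_nat p + of_int v * of_int k = (1::'a)"
      by (metis of_int_add of_int_mult of_int_of_nat_eq of_int_1)
    moreover have "of_int u * of_nat p + of_int v * of_int k \<in> P"
      using p_in_P k by (intro P_add P_mult) (simp_all add: int_imp_algebraic_int)
    ultimately show False using one_notin_P by simp
  qed
next
  assume "int p dvd k"
  then obtain j where "k = j * int p" by (metis dvdE mult.commute)
  then show "of_int k \<in> P" using P_mult[OF _ p_in_P, of "of_int j"] by (simp add: int_imp_algebraic_int)
qed

sublocale p_congruence p P
  by unfold_locales (auto intro: algebraic_int_p_integral P_algebraic_int)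

lemma congruence_ideal_subset_localization: "congruence_ideal \<subseteq> localization P"
proof (rule ring.genideal_minimal[OF cring.axioms(1)[OF cring_p_integers]])
  show "ideal (localization P) (p_integers p)"
  proof (rule ideal_p_integersI)
    show "localization P \<subseteq> p_integral"
      using P_algebraic_int unfolding p_integral_eq_localization localization_def by blast
    show "0 \<in> localization P" using P_mult[OF _ p_in_P, of 0] by (intro localization_base) simp
    show "x + y \<in> localization P" if "x \<in> localization P" "y \<in> localization P" for x y
      using that by (rule localization_add[rotated 2]) (simp_all add: P_add P_mult int_imp_algebraic_int)
    show "r * x \<in> localization P" if "r \<in> p_integral" "x \<in> localization P" for r x
      using that unfolding p_integral_eq_localization
      by (rule localization_mult[rotated]) (simp add: P_mult)
  qed
  show "P \<subseteq> localization P" by (simp add: localization_base subsetI)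
qed

lemma p_cong_algebraic_int_iff:
  assumes "algebraic_int x" "algebraic_int y"
  shows "p_cong p P x y \<longleftrightarrow> x - y \<in> P"
proof
  assume "p_cong p P x y"
  then obtain m where m: "\<not> int p dvd m" "of_int m * (x - y) \<in> P"
    using congruence_ideal_subset_localization by (auto simp: p_cong_def localization_def)
  then show "x - y \<in> P"
    using P_prime[of "of_int m" "x - y"] of_int_in_P_iff assms
    by (simp add: int_imp_algebraic_int algebraic_int_diff)
next
  assume "x - y \<in> P"
  then have "x - y \<in> congruence_ideal"
    using ring.genideal_self[OF cring.axioms(1)[OF cring_p_integers] S_p_integral] by blast
  then show "p_cong p P x y" using assms by (simp add: p_cong_def algebraic_int_p_integral)
qed

lemma p_cong_if_mod_p: "p_cong p {of_nat p} x y \<Longrightarrow> p_cong p P x y"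
  using p_cong_mono[of "{of_nat p}"] p_in_P by simp

lemma p_integral_obtain_cong_algebraic_int:
  assumes "x \<in> p_integral"
  obtains a where "algebraic_int a" "p_cong p P x a"
proof -
  obtain m where "algebraic_int (of_int m * x)" "p_cong p {of_nat p} x (of_int m * x)"
    using p_integral_obtain_algebraic_int_multiple[OF assms] .
  then show ?thesis using that p_cong_if_mod_p by blast
qed

lemma not_p_cong_one_zero: "\<not> p_cong p P 1 0"
  using one_notin_P by (subst p_cong_algebraic_int_iff) simp_all

lemma p_cong_mult_zero:
  assumes "x \<in> p_integral" "y \<in> p_integral" "p_cong p P (x * y) 0"
  shows "p_cong p P x 0 \<or> p_cong p P y 0"
proof -
  obtain a where a: "algebraic_int a" "p_cong p P x a"
    using p_integral_obtain_cong_algebraic_int[OF assms(1)] .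
  obtain b where b: "algebraic_int b" "p_cong p P y b"
    using p_integral_obtain_cong_algebraic_int[OF assms(2)] .
  have "p_cong p P (a * b) (x * y)" using p_cong_mult[OF a(2) b(2)] by (rule p_cong_sym)
  also note assms(3)
  finally have "a \<in> P \<or> b \<in> P"
    using P_prime a(1) b(1) by (simp add: p_cong_algebraic_int_iff algebraic_int_mult)
  then have "p_cong p P a 0 \<or> p_cong p P b 0" using a(1) b(1) by (simp add: p_cong_algebraic_int_iff)
  then show ?thesis using p_cong_trans[OF a(2)] p_cong_trans[OF b(2)] by blast
qed

lemma p_cong_prod_zero:
  assumes "finite A" "\<And>i. i \<in> A \<Longrightarrow> f i \<in> p_integral" "p_cong p P (prod f A) 0"
  shows "\<exists>i\<in>A. p_cong p P (f i) 0"
  using assms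
proof (induction A rule: finite_induct)
  case empty
  then show ?case using not_p_cong_one_zero by simp
next
  case (insert i A)
  then have "p_cong p P (f i) 0 \<or> p_cong p P (prod f A) 0" by (intro p_cong_mult_zero) simp_all
  then show ?case using insert.IH insert.prems(1) by auto
qed

lemma unit_not_p_cong_zero:
  assumes "x \<noteq> 0" "inverse x \<in> p_integral"
  shows "\<not> p_cong p P x 0"
  using p_cong_mult_right[OF assms(2), of x 0] assms(1) not_p_cong_one_zero by auto

end

lemma (in domain) finite_imp_field:
  assumes "finite (carrier R)"
  shows "Ring.field R"
proof (rule cring_fieldI2)
  show "\<zero> \<noteq> \<one>" using one_not_zero by simp
  fix a assume a: "a \<in> carrier R" "a \<noteq> \<zero>"
  have "inj_on ((\<otimes>) a) (carrier R)" using a by (auto intro!: inj_onI simp: m_lcancel)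
  moreover have "(\<otimes>) a ` carrier R \<subseteq> carrier R" using a by auto
  ultimately have "(\<otimes>) a ` carrier R = carrier R" using assms by (intro endo_inj_surj)
  then show "\<exists>b\<in>carrier R. a \<otimes> b = \<one>" using one_closed by (metis imageE)
qed

lemma (in domain) finite_subring_imp_subfield:
  assumes "subring K R" "finite K"
  shows "subfield K R"
proof (rule subfield_iff(1))
  interpret K: domain "R\<lparr>carrier := K\<rparr>" using assms(1) by (rule subring_is_domain)
  show "Ring.field (R\<lparr>carrier := K\<rparr>)" using assms(2) by (intro K.finite_imp_field) simp
  show "K \<subseteq> carrier R" using assms(1) by (rule subringE)
qed

lemma (in ring) card_dimension:
  assumes "subfield K R" "dimension n K E" "finite K"
  shows "card E = card K ^ n"
proof -
  obtain Us where Us: "set Us \<subseteq> carrier R" "independent K Us" "length Us = n" "Span K Us = E"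
    using exists_base[OF assms(1,2)] by blast
  let ?L = "{Ks. set Ks \<subseteq> K \<and> length Ks = n}"
  have mem: "a \<in> E \<longleftrightarrow> (\<exists>Ks. set Ks \<subseteq> K \<and> length Ks = length Us \<and> a = combine Ks Us)" for a
    using Span_mem_iff_length_version[OF assms(1) Us(1), of a] Us(4) by blast
  have "bij_betw (\<lambda>Ks. combine Ks Us) ?L E"
    unfolding bij_betw_def
  proof
    show "inj_on (\<lambda>Ks. combine Ks Us) ?L"
    proof (rule inj_onI)
      fix Ks Ls assume Ks_Ls: "Ks \<in> ?L" "Ls \<in> ?L" "combine Ks Us = combine Ls Us"
      have "combine Ks Us \<in> Span K Us" using mem[of "combine Ks Us"] Ks_Ls Us(3,4) by auto
      from unique_decomposition[OF assms(1) Us(2) this] show "Ks = Ls"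
        by (rule ex1E) (use Ks_Ls Us(3) in \<open>metis (lifting) mem_Collect_eq\<close>)
    qed
    show "(\<lambda>Ks. combine Ks Us) ` ?L = E" using mem Us(3) by auto
  qed
  then have "card E = card ?L" by (simp add: bij_betw_same_card)
  then show ?thesis using card_lists_length_eq[OF assms(3)] by simp
qed

lemma (in ring) card_carrier_eq_power_dim:
  assumes "subfield K R" "finite (carrier R)"
  shows "card (carrier R) = card K ^ dim K (carrier R)"
proof -
  have K: "K \<subseteq> carrier R" using assms(1) by (rule subfieldE)
  obtain xs where xs: "set xs = carrier R" using finite_list[OF assms(2)] by blast
  have "Span K xs = carrier R"
  proof
    show "Span K xs \<subseteq> carrier R" using K xs by (intro Span_in_carrier) auto
    show "carrier R \<subseteq> Span K xs" using Span_base_incl[OF assms(1), of xs] xs by simp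
  qed
  then have "finite_dimension K (carrier R)" using Span_finite_dimension[OF assms(1), of xs] xs by simp
  then have "dimension (dim K (carrier R)) K (carrier R)"
    using finite_dimensionE[OF assms(1)] by (simp add: over_def)
  then show ?thesis using assms finite_subset[OF K] by (intro card_dimension)
qed

context prime_above
begin

definition residue :: "'a \<Rightarrow> 'a set" where
  "residue x = P +>\<^bsub>ring_of_integers\<^esub> x"

lemma domain_residue_field: "domain residue_field"
  using primeideal_P by (rule primeideal.quotient_is_domain)

lemma residue_ring_hom: "residue \<in> ring_hom ring_of_integers residue_field"
  using ideal.rcos_ring_hom[OF primeideal.axioms(1)[OF primeideal_P]] by (simp add: residue_def[abs_def])

lemma residue_closed: "algebraic_int x \<Longrightarrow> residue x \<in> carrier residue_field"
  and residue_mult: "algebraic_int x \<Longrightarrow> algebraic_int y \<Longrightarrow>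
      residue (x * y) = residue x \<otimes>\<^bsub>residue_field\<^esub> residue y"
  and residue_add: "algebraic_int x \<Longrightarrow> algebraic_int y \<Longrightarrow>
      residue (x + y) = residue x \<oplus>\<^bsub>residue_field\<^esub> residue y"
  and residue_one: "residue 1 = \<one>\<^bsub>residue_field\<^esub>"
  using ring_hom_closed[OF residue_ring_hom, of x] ring_hom_mult[OF residue_ring_hom, of x y]
    ring_hom_add[OF residue_ring_hom, of x y] ring_hom_one[OF residue_ring_hom]
  by simp_all

lemma residue_zero: "residue 0 = \<zero>\<^bsub>residue_field\<^esub>"
  using ring_hom_zero[OF residue_ring_hom cring.axioms(1)[OF cring_ring_of_integers]] domain_residue_field
  by (simp add: domain_def cring_def)

lemma residue_power: "algebraic_int x \<Longrightarrow> residue (x ^ k) = residue x [^]\<^bsub>residue_field\<^esub> k"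
proof (induction k)
  case (Suc k)
  interpret F: domain residue_field by (rule domain_residue_field)
  have "residue (x ^ k * x) = residue (x ^ k) \<otimes>\<^bsub>residue_field\<^esub> residue x"
    using Suc.prems by (intro residue_mult algebraic_int_power)
  then show ?case using Suc by (simp add: mult.commute)
qed (simp add: residue_one)

lemma residue_eq_iff:
  assumes "algebraic_int x" "algebraic_int y"
  shows "residue x = residue y \<longleftrightarrow> p_cong p P x y"
proof -
  interpret O: cring "ring_of_integers :: 'a ring" by (rule cring_ring_of_integers)
  have "\<ominus>\<^bsub>ring_of_integers\<^esub> y = - y"
    using assms(2) by (intro O.minus_equality) auto
  then have "x \<ominus>\<^bsub>ring_of_integers\<^esub> y = x - y"
    by (simp add: a_minus_def)
  then show ?thesis
    using O.quotient_eq_iff_same_a_r_cos[OF primeideal.axioms(1)[OF primeideal_P], of x y] assms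
    by (simp add: p_cong_algebraic_int_iff residue_def)
qed

lemma carrier_residue_field: "carrier residue_field = residue ` {x. algebraic_int x}"
  by (auto simp: FactRing_def A_RCOSETS_def' residue_def)

definition prime_field :: "'a set set" where
  "prime_field = range (\<lambda>m::int. residue (of_int m))"

lemma card_prime_field: "card prime_field = p"
proof -
  have eq_iff: "residue (of_int i) = residue (of_int j) \<longleftrightarrow> i mod int p = j mod int p" for i j
    using of_int_in_P_iff[of "i - j"]
    by (simp add: residue_eq_iff p_cong_algebraic_int_iff int_imp_algebraic_int mod_eq_dvd_iff)
  have "residue (of_int m) = residue (of_int (m mod int p))" for m by (simp add: eq_iff)
  then have "prime_field = (\<lambda>m. residue (of_int m)) ` {0..<int p}"
    unfolding prime_field_def using p_pos by (auto intro!: image_eqI[of _ _ "_ mod int p"])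
  moreover have "inj_on (\<lambda>m. residue (of_int m)) {0..<int p}"
    by (rule inj_onI) (simp add: eq_iff)
  ultimately show ?thesis by (simp add: card_image)
qed

lemma subring_prime_field: "subring prime_field residue_field"
proof -
  interpret F: domain residue_field by (rule domain_residue_field)
  have Z: "ring INTEG" using INTEG_cring by (rule cring.axioms(1))
  have "ring_hom_ring INTEG residue_field (\<lambda>m. residue (of_int m))"
    using Z F.ring_axioms
    by (rule ring_hom_ringI)
      (simp_all add: INTEG_def residue_closed residue_mult residue_add residue_one int_imp_algebraic_int)
  from ring_hom_ring.img_is_subring[OF this ring.carrier_is_subring[OF Z]] show ?thesis
    by (simp add: prime_field_def INTEG_def)
qed

lemma card_residue_field:
  assumes "finite (carrier residue_field)"
  shows "card (carrier residue_field) = p ^ residue_degree P"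
proof -
  interpret F: domain residue_field by (rule domain_residue_field)
  have "finite prime_field"
    using finite_subset[OF subringE(1)[OF subring_prime_field] assms] .
  then have "subfield prime_field residue_field" by (intro F.finite_subring_imp_subfield subring_prime_field)
  from F.card_carrier_eq_power_dim[OF this assms] card_prime_field
  show ?thesis by (simp add: residue_degree_def prime_field_def residue_def)
qed

lemma p_cong_fermat:
  assumes "finite (carrier residue_field)" "x \<in> p_integral" "\<not> p_cong p P x 0"
  shows "p_cong p P (x ^ (p ^ residue_degree P - 1)) 1"
proof -
  let ?N = "p ^ residue_degree P - 1"
  interpret F: domain residue_field by (rule domain_residue_field)
  interpret F: Ring.field residue_field using assms(1) by (rule F.finite_imp_field)
  obtain a where a: "algebraic_int a" "p_cong p P x a"
    using p_integral_obtain_cong_algebraic_int[OF assms(2)] .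
  have "\<not> p_cong p P a 0" using p_cong_trans[OF a(2)] assms(3) by blast
  then have "residue a \<in> Units residue_field"
    using a(1) residue_eq_iff[of a 0] by (simp add: F.field_Units residue_closed residue_zero)
  then have "residue a [^]\<^bsub>residue_field\<^esub> card (Units residue_field) = \<one>\<^bsub>residue_field\<^esub>"
    using assms(1) by (intro F.units_power_order_eq_one F.finite_ring_finite_units) simp_all
  moreover have "card (Units residue_field) = ?N"
    using assms(1) by (simp add: F.field_Units card_Diff_singleton card_residue_field)
  ultimately have "residue (a ^ ?N) = residue 1" using a(1) by (simp add: residue_power residue_one)
  then have "p_cong p P (a ^ ?N) 1" using a(1) by (simp add: residue_eq_iff algebraic_int_power)
  with p_cong_power[OF a(2)] show ?thesis by (rule p_cong_trans)
qed

lemma residue_degree_le: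
  assumes "finite (carrier residue_field)" "m > 0" "\<And>x. algebraic_int x \<Longrightarrow> p_cong p P (x ^ (p ^ m)) x"
  shows "residue_degree P \<le> m"
proof -
  interpret F: domain residue_field by (rule domain_residue_field)
  let ?d = "p ^ m - 1"
  have p1: "p > 1" using prime_p by (rule prime_gt_1_nat)
  then have d: "?d \<noteq> 0" "Suc ?d = p ^ m" using one_less_power[OF p1 assms(2)] by auto
  have "a [^]\<^bsub>residue_field\<^esub> ?d = \<one>\<^bsub>residue_field\<^esub>" if a: "a \<in> carrier residue_field" "a \<noteq> \<zero>\<^bsub>residue_field\<^esub>" for a
  proof -
    from a(1) obtain x where x: "algebraic_int x" "a = residue x" by (auto simp: carrier_residue_field)
    have "residue (x ^ (p ^ m)) = residue x"
      using assms(3)[OF x(1)] x(1) by (simp add: residue_eq_iff algebraic_int_power)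
    then have "a [^]\<^bsub>residue_field\<^esub> Suc ?d = a" using x d(2) by (simp add: residue_power)
    then have "a [^]\<^bsub>residue_field\<^esub> ?d \<otimes>\<^bsub>residue_field\<^esub> a = \<one>\<^bsub>residue_field\<^esub> \<otimes>\<^bsub>residue_field\<^esub> a" using a by simp
    then show ?thesis using a by (subst (asm) F.m_rcancel) auto
  qed
  then have "card (carrier residue_field - {\<zero>\<^bsub>residue_field\<^esub>})
      \<le> card {a \<in> carrier residue_field. a [^]\<^bsub>residue_field\<^esub> ?d = \<one>\<^bsub>residue_field\<^esub>}"
    using assms(1) by (intro card_mono) auto
  also have "\<dots> \<le> ?d" using F.num_roots_le_deg[OF assms(1) d(1)] .
  finally have "p ^ residue_degree P - 1 \<le> ?d"
    using card_residue_field[OF assms(1)] assms(1) by (simp add: card_Diff_singleton)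
  then have "p ^ residue_degree P \<le> p ^ m" using d by linarith
  then show ?thesis using p1 by (rule power_le_imp_le_exp[rotated])
qed

end

section \<open>Frobenius elements\<close>

locale galois_generator =
  fixes \<alpha> :: "'a::field_char_0"
  assumes finite_Gal: "finite (Gal :: ('a \<Rightarrow> 'a) set)"
    and fixed_imp_Rats: "\<And>x :: 'a. (\<And>\<sigma>. \<sigma> \<in> Gal \<Longrightarrow> \<sigma> x = x) \<Longrightarrow> x \<in> \<rat>"
    and conjugates_distinct: "inj_on (\<lambda>\<sigma>. \<sigma> \<alpha>) Gal"
begin

definition conjugate_poly :: "'a \<Rightarrow> 'a poly" where
  "conjugate_poly x = (\<Prod>\<sigma>\<in>Gal. [:- \<sigma> x, 1:])"

text \<open>The value of the derivative of \<open>conjugate_poly \<alpha>\<close> at \<open>\<alpha>\<close>.\<close>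

definition different :: 'a where
  "different = (\<Prod>\<tau>\<in>Gal - {id}. \<alpha> - \<tau> \<alpha>)"

text \<open>Lagrange interpolation: \<open>lagrange x\<close> takes the value \<open>\<sigma> (x * different)\<close> at \<open>\<sigma> \<alpha>\<close>.\<close>

definition lagrange :: "'a \<Rightarrow> 'a poly" where
  "lagrange x = (\<Sum>\<sigma>\<in>Gal. smult (\<sigma> x) (\<Prod>\<tau>\<in>Gal - {\<sigma>}. [:- \<tau> \<alpha>, 1:]))"

lemma different_nonzero: "different \<noteq> 0"
  using finite_Gal inj_onD[OF conjugates_distinct, of id] by (auto simp: different_def)

lemma coeff_Rats_if_Gal_invariant:
  assumes "\<And>\<sigma>. \<sigma> \<in> Gal \<Longrightarrow> map_poly \<sigma> g = (g :: 'a poly)"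
  shows "coeff g i \<in> \<rat>"
proof (rule fixed_imp_Rats)
  fix \<sigma> :: "'a \<Rightarrow> 'a" assume \<sigma>: "\<sigma> \<in> Gal"
  have "coeff (map_poly \<sigma> g) i = \<sigma> (coeff g i)" by (simp add: coeff_map_poly Gal_zero[OF \<sigma>])
  then show "\<sigma> (coeff g i) = coeff g i" by (simp only: assms[OF \<sigma>])
qed

lemma map_poly_Gal_prod_linear:
  assumes "\<rho> \<in> Gal" "A \<subseteq> Gal"
  shows "map_poly \<rho> (\<Prod>\<sigma>\<in>A. [:- \<sigma> x, 1:]) = (\<Prod>\<sigma>\<in>(\<circ>) \<rho> ` A. [:- \<sigma> (x :: 'a), 1:])"
proof -
  interpret field_hom \<rho> using assms(1) by (rule Gal_field_hom)
  interpret map_hom: map_poly_idom_hom \<rho> ..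
  have "inj_on ((\<circ>) \<rho>) A"
    using bij_betw_comp_Gal[OF assms(1)] assms(2) by (auto simp: bij_betw_def intro: inj_on_subset)
  then have "(\<Prod>\<sigma>\<in>(\<circ>) \<rho> ` A. [:- \<sigma> x, 1:]) = (\<Prod>\<sigma>\<in>A. [:- \<rho> (\<sigma> x), 1:])"
    by (simp add: prod.reindex)
  then show ?thesis by (simp add: map_hom.hom_prod map_poly_pCons_hom hom_uminus)
qed

lemma coeff_conjugate_poly_Rats: "coeff (conjugate_poly x) i \<in> \<rat>"
proof (rule coeff_Rats_if_Gal_invariant)
  fix \<rho> :: "'a \<Rightarrow> 'a" assume \<rho>: "\<rho> \<in> Gal"
  then have "(\<circ>) \<rho> ` Gal = Gal" by (intro bij_betw_imp_surj_on bij_betw_comp_Gal)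
  then show "map_poly \<rho> (conjugate_poly x) = conjugate_poly x"
    by (simp add: conjugate_poly_def map_poly_Gal_prod_linear[OF \<rho>])
qed

lemma conjugate_poly_root: "poly (conjugate_poly x) x = 0"
  unfolding conjugate_poly_def poly_prod using finite_Gal by (intro prod_zero bexI[of _ id]) simp_all

lemma algebraic: "algebraic (x :: 'a)"
proof (rule algebraicI')
  show "conjugate_poly x \<noteq> 0" by (simp add: conjugate_poly_def finite_Gal)
qed (use coeff_conjugate_poly_Rats conjugate_poly_root in auto)

lemma coeff_lagrange_Rats: "coeff (lagrange x) i \<in> \<rat>"
proof (rule coeff_Rats_if_Gal_invariant)
  fix \<rho> :: "'a \<Rightarrow> 'a" assume \<rho>: "\<rho> \<in> Gal"
  interpret field_hom \<rho> using \<rho> by (rule Gal_field_hom)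
  interpret map_hom: map_poly_idom_hom \<rho> ..
  let ?term = "\<lambda>\<sigma>. smult (\<sigma> x) (\<Prod>\<tau>\<in>Gal - {\<sigma>}. [:- \<tau> \<alpha>, 1:])"
  have bij: "bij_betw ((\<circ>) \<rho>) Gal Gal" using \<rho> by (rule bij_betw_comp_Gal)
  have "map_poly \<rho> (?term \<sigma>) = ?term (\<rho> \<circ> \<sigma>)" if \<sigma>: "\<sigma> \<in> Gal" for \<sigma>
  proof -
    have "(\<circ>) \<rho> ` (Gal - {\<sigma>}) = Gal - {\<rho> \<circ> \<sigma>}"
      using bij \<sigma> by (auto simp: bij_betw_def inj_on_image_set_diff[of _ Gal])
    then show ?thesis using \<rho> by (simp add: map_poly_hom_smult map_poly_Gal_prod_linear)
  qed
  then have "map_poly \<rho> (lagrange x) = (\<Sum>\<sigma>\<in>Gal. ?term (\<rho> \<circ> \<sigma>))"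
    by (simp add: lagrange_def map_hom.hom_sum)
  also have "\<dots> = lagrange x"
    unfolding lagrange_def using sum.reindex_bij_betw[OF bij, of ?term] .
  finally show "map_poly \<rho> (lagrange x) = lagrange x" .
qed

lemma poly_lagrange: "poly (lagrange x) \<alpha> = x * different"
proof -
  have "poly (lagrange x) \<alpha> = (\<Sum>\<sigma>\<in>Gal. \<sigma> x * (\<Prod>\<tau>\<in>Gal - {\<sigma>}. \<alpha> - \<tau> \<alpha>))"
    by (simp add: lagrange_def poly_sum poly_prod)
  also have "\<dots> = (\<Sum>\<sigma>\<in>(Gal :: ('a \<Rightarrow> 'a) set). if \<sigma> = id then x * different else 0)"
  proof (rule sum.cong[OF refl])
    fix \<sigma> :: "'a \<Rightarrow> 'a"
    show "\<sigma> x * (\<Prod>\<tau>\<in>Gal - {\<sigma>}. \<alpha> - \<tau> \<alpha>) = (if \<sigma> = id then x * different else 0)"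
    proof (cases "\<sigma> = id")
      case False
      then have "(\<Prod>\<tau>\<in>Gal - {\<sigma>}. \<alpha> - \<tau> \<alpha>) = 0"
        using finite_Gal by (intro prod_zero bexI[of _ id]) simp_all
      then show ?thesis using False by simp
    qed (simp add: different_def)
  qed
  also have "\<dots> = x * different" using finite_Gal by simp
  finally show ?thesis .
qed

lemma degree_lagrange: "degree (lagrange x) \<le> card (Gal :: ('a \<Rightarrow> 'a) set)"
  unfolding lagrange_def
proof (rule degree_sum_le[OF finite_Gal])
  fix \<sigma> :: "'a \<Rightarrow> 'a"
  have "degree (smult (\<sigma> x) (\<Prod>\<tau>\<in>Gal - {\<sigma>}. [:- \<tau> \<alpha>, 1:])) \<le> degree (\<Prod>\<tau>\<in>Gal - {\<sigma>}. [:- \<tau> \<alpha>, 1:])"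
    by (rule degree_smult_le)
  also have "\<dots> \<le> (\<Sum>\<tau>\<in>Gal - {\<sigma>}. 1)"
    using degree_prod_sum_le[of "Gal - {\<sigma>}" "\<lambda>\<tau>. [:- \<tau> \<alpha>, 1:]"] finite_Gal by simp
  also have "\<dots> \<le> card (Gal :: ('a \<Rightarrow> 'a) set)" using finite_Gal by (simp add: card_mono)
  finally show "degree (smult (\<sigma> x) (\<Prod>\<tau>\<in>Gal - {\<sigma>}. [:- \<tau> \<alpha>, 1:])) \<le> card (Gal :: ('a \<Rightarrow> 'a) set)" .
qed

lemma eventually_p_integral:
  "\<forall>\<^sub>F p in sequentially. Factorial_Ring.prime p \<longrightarrow> (x :: 'a) \<in> carrier (p_integers p)"
proof -
  obtain d :: int where d: "d \<noteq> 0" "algebraic_int (of_int d * x)"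
    using algebraic_obtain_algebraic_int_multiple[OF algebraic] .
  show ?thesis
    using eventually_gt_at_top[of "nat \<bar>d\<bar>"]
  proof eventually_elim
    case (elim p)
    then have "\<not> int p dvd d" using dvd_imp_le_int[OF d(1), of "int p"] by auto
    then show ?case
      using d(2) rational_prime.p_integral_eq_localization rational_prime.localization_def
      by (metis (no_types, lifting) mem_Collect_eq rational_prime.intro)
  qed
qed

end

text \<open>A prime at which \<open>\<alpha>\<close> generates the ring of p-integral elements.\<close>

locale good_prime = galois_generator \<alpha> + rational_prime p for \<alpha> :: "'a::field_char_0" and p :: nat +
  assumes generator_p_integral: "\<alpha> \<in> p_integral"
    and inverse_different_p_integral: "inverse different \<in> p_integral"
begin

lemma coeff_prod_linear_p_integral:
  "coeff (\<Prod>\<sigma>\<in>A. [:- f \<sigma>, 1:]) i \<in> p_integral"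
  if "\<And>\<sigma>. \<sigma> \<in> A \<Longrightarrow> f \<sigma> \<in> p_integral" for f :: "'b \<Rightarrow> 'a"
  using that
proof (induction A arbitrary: i rule: infinite_finite_induct)
  case (insert \<sigma> A)
  have "coeff [:- f \<sigma>, 1:] j \<in> p_integral" for j
    using insert.prems[of \<sigma>] by (auto simp: coeff_pCons split: nat.split)
  then have "coeff ([:- f \<sigma>, 1:] * (\<Prod>\<sigma>\<in>A. [:- f \<sigma>, 1:])) i \<in> p_integral"
    using insert.IH insert.prems unfolding coeff_mult by (intro p_integral_sum p_integral_mult) auto
  then show ?case using insert.hyps by (simp only: prod.insert not_False_eq_True)
qed auto

lemma p_integral_obtain_poly:
  assumes "x \<in> p_integral"
  obtains g where "\<And>i. coeff g i \<in> p_integral" "\<And>i. coeff g i \<in> \<rat>"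
    "degree g \<le> card (Gal :: ('a \<Rightarrow> 'a) set)" "poly g \<alpha> = x"
proof (rule that)
  let ?g = "lagrange (x * inverse different)"
  have "x * inverse different \<in> p_integral"
    using assms inverse_different_p_integral by simp
  then have "\<sigma> (x * inverse different) \<in> p_integral" "\<sigma> \<alpha> \<in> p_integral" if "\<sigma> \<in> Gal" for \<sigma>
    using p_integral_Gal[OF that] generator_p_integral by simp_all
  then show "coeff ?g i \<in> p_integral" for i
    unfolding lagrange_def coeff_sum coeff_smult
    by (intro p_integral_sum p_integral_mult coeff_prod_linear_p_integral) simp_all
  show "poly ?g \<alpha> = x" using different_nonzero by (simp add: poly_lagrange)
qed (rule coeff_lagrange_Rats degree_lagrange)+

lemma finite_residue_system:
  "\<exists>T :: 'a set. finite T \<and> (\<forall>x\<in>p_integral. \<exists>t\<in>T. p_cong p {of_nat p} x t)"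
proof (intro exI conjI ballI)
  let ?N = "card (Gal :: ('a \<Rightarrow> 'a) set)"
  let ?eval = "\<lambda>c. \<Sum>i\<le>?N. of_int (c i) * \<alpha> ^ i"
  let ?C = "{..?N} \<rightarrow>\<^sub>E {0..<int p}"
  show "finite (?eval ` ?C)" by (intro finite_imageI finite_PiE) auto
  fix x :: 'a assume "x \<in> p_integral"
  then obtain g where g: "\<And>i. coeff g i \<in> p_integral" "\<And>i. coeff g i \<in> \<rat>" "degree g \<le> ?N" "poly g \<alpha> = x"
    using p_integral_obtain_poly by blast
  have "\<exists>c. c \<in> {0..<int p} \<and> p_cong p {of_nat p} (coeff g i) (of_int c)" for i
    using Rats_obtain_int_residue[OF g(1,2)] by metis
  then obtain c where c: "\<And>i. c i \<in> {0..<int p}" "\<And>i. p_cong p {of_nat p} (coeff g i) (of_int (c i))"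
    by metis
  have "x = (\<Sum>i\<le>?N. coeff g i * \<alpha> ^ i)"
    unfolding g(4)[symmetric] poly_altdef
    by (rule sum.mono_neutral_left) (use g(3) in \<open>auto simp: coeff_eq_0\<close>)
  also have "p_cong p {of_nat p} \<dots> (?eval c)"
    using c(2) generator_p_integral by (intro mod_p.p_cong_sum mod_p.p_cong_mult) simp_all
  also have "?eval c = ?eval (restrict c {..?N})" by (intro sum.cong) simp_all
  finally have "p_cong p {of_nat p} x (?eval (restrict c {..?N}))" .
  moreover have "restrict c {..?N} \<in> ?C" using c(1) by (simp only: restrict_PiE_iff) blast
  ultimately show "\<exists>t\<in>?eval ` ?C. p_cong p {of_nat p} x t" by (rule bexI[OF _ imageI])
qed

lemma infinite_congruent_subset:
  fixes f :: "'b \<Rightarrow> 'a"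
  assumes "infinite A" "\<forall>a\<in>A. f a \<in> p_integral"
  shows "\<exists>B\<subseteq>A. infinite B \<and> (\<forall>a\<in>B. \<forall>b\<in>B. p_cong p {of_nat p} (f a) (f b))"
proof -
  obtain T :: "'a set" where T: "finite T" "\<forall>x\<in>p_integral. \<exists>t\<in>T. p_cong p {of_nat p} x t"
    using finite_residue_system by blast
  have "\<forall>a\<in>A. \<exists>t\<in>T. p_cong p {of_nat p} (f a) t" using T(2) assms(2) by blast
  from pigeonhole_infinite_rel[OF assms(1) T(1) this]
  obtain t where t: "infinite {a \<in> A. p_cong p {of_nat p} (f a) t}" by blast
  have "p_cong p {of_nat p} (f a) (f b)"
    if "p_cong p {of_nat p} (f a) t" "p_cong p {of_nat p} (f b) t" for a b
    using that(1) mod_p.p_cong_sym[OF that(2)] by (rule mod_p.p_cong_trans)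
  with t show ?thesis by (intro exI[of _ "{a \<in> A. p_cong p {of_nat p} (f a) t}"]) auto
qed

lemma unit_power_cong_one:
  fixes x :: 'a
  assumes "x \<noteq> 0" "x \<in> p_integral" "inverse x \<in> p_integral"
  obtains k where "k \<ge> 1" "p_cong p {of_nat p} (x ^ k) 1"
proof -
  obtain B where B: "infinite B" "\<forall>i\<in>B. \<forall>j\<in>B. p_cong p {of_nat p} (x ^ i) (x ^ j)"
    using infinite_congruent_subset[OF infinite_UNIV_nat, of "\<lambda>i. x ^ i"] assms(2) by auto
  obtain i where i: "i \<in> B" using infinite_imp_nonempty[OF B(1)] by blast
  obtain j where j: "j \<in> B" "i < j" using B(1) infinite_nat_iff_unbounded[of B] by blast
  have "p_cong p {of_nat p} (x ^ j * inverse x ^ i) (x ^ i * inverse x ^ i)"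
    using B(2) i j(1) assms(3) by (intro mod_p.p_cong_mult_right) simp_all
  moreover have "x ^ j * inverse x ^ i = x ^ (j - i)" "x ^ i * inverse x ^ i = 1"
    using assms(1) j(2) by (simp_all add: power_diff power_inverse divide_inverse)
  ultimately show ?thesis using that[of "j - i"] j(2) by simp
qed

end

locale good_prime_above = good_prime \<alpha> p + prime_above p P
  for \<alpha> :: "'a::field_char_0" and p :: nat and P :: "'a set"
begin

lemma finite_residue_field: "finite (carrier residue_field)"
proof (rule ccontr)
  assume "infinite (carrier residue_field)"
  let ?rep = "inv_into {x. algebraic_int x} residue"
  have rep: "algebraic_int (?rep a)" "residue (?rep a) = a" if "a \<in> carrier residue_field" for a
    using that inv_into_into[of a residue "{x. algebraic_int x}"] f_inv_into_f[of a residue]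
    by (simp_all add: carrier_residue_field)
  then have "\<forall>a\<in>carrier residue_field. ?rep a \<in> p_integral" using algebraic_int_p_integral by blast
  with \<open>infinite (carrier residue_field)\<close> obtain B where B: "B \<subseteq> carrier residue_field" "infinite B"
      "\<forall>a\<in>B. \<forall>b\<in>B. p_cong p {of_nat p} (?rep a) (?rep b)"
    using infinite_congruent_subset by metis
  obtain a where a: "a \<in> B" using infinite_imp_nonempty[OF B(2)] by blast
  have "b = a" if b: "b \<in> B" for b
  proof -
    have ab: "a \<in> carrier residue_field" "b \<in> carrier residue_field" using a b B(1) by auto
    have "p_cong p P (?rep b) (?rep a)" using B(3) a b by (intro p_cong_if_mod_p) blast
    then have "residue (?rep b) = residue (?rep a)" using ab rep(1) by (simp add: residue_eq_iff)
    then show ?thesis using ab rep(2) by simp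
  qed
  then have "B \<subseteq> {a}" by blast
  then show False using B(2) finite_subset by blast
qed

definition frobenius :: "('a \<Rightarrow> 'a) \<Rightarrow> bool" where
  "frobenius \<sigma> \<longleftrightarrow> \<sigma> \<in> Gal \<and> (\<forall>x\<in>p_integral. p_cong p P (\<sigma> x) (x ^ p))"

lemma frobenius_exists: "\<exists>\<sigma>. frobenius \<sigma>"
proof -
  have conj: "\<sigma> \<alpha> \<in> p_integral" if "\<sigma> \<in> Gal" for \<sigma>
    using that generator_p_integral by (rule p_integral_Gal)
  then have coeff: "coeff (conjugate_poly \<alpha>) i \<in> p_integral" for i
    unfolding conjugate_poly_def by (rule coeff_prod_linear_p_integral)
  have "p_cong p P (poly (conjugate_poly \<alpha>) (\<alpha> ^ p)) (poly (conjugate_poly \<alpha>) \<alpha> ^ p)"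
    using p_cong_poly_frobenius[OF coeff coeff_conjugate_poly_Rats generator_p_integral]
    by (rule p_cong_sym[OF p_cong_if_mod_p])
  also have "poly (conjugate_poly \<alpha>) \<alpha> ^ p = 0" using p_pos by (simp add: conjugate_poly_root)
  finally have "p_cong p P (\<Prod>\<sigma>\<in>Gal. \<alpha> ^ p - \<sigma> \<alpha>) 0"
    by (simp add: conjugate_poly_def poly_prod)
  then obtain \<sigma> where \<sigma>: "\<sigma> \<in> Gal" "p_cong p P (\<alpha> ^ p - \<sigma> \<alpha>) 0"
    using p_cong_prod_zero[OF finite_Gal, of "\<lambda>\<sigma>. \<alpha> ^ p - \<sigma> \<alpha>"] generator_p_integral conj by auto
  then have generator: "p_cong p P (\<alpha> ^ p) (\<sigma> \<alpha>)"
    using generator_p_integral conj by (subst p_cong_iff_diff) simp_all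
  have "p_cong p P (\<sigma> x) (x ^ p)" if x: "x \<in> p_integral" for x
  proof -
    obtain g where g: "\<And>i. coeff g i \<in> p_integral" "\<And>i. coeff g i \<in> \<rat>" "poly g \<alpha> = x"
      using p_integral_obtain_poly[OF x] by metis
    have "p_cong p P (x ^ p) (poly g (\<alpha> ^ p))"
      unfolding g(3)[symmetric] using g(1,2) generator_p_integral
      by (intro p_cong_if_mod_p p_cong_poly_frobenius)
    also have "p_cong p P (poly g (\<alpha> ^ p)) (poly g (\<sigma> \<alpha>))"
      using g(1) generator by (rule p_cong_poly)
    also have "poly g (\<sigma> \<alpha>) = \<sigma> x"
      using poly_Gal_rat[OF \<sigma>(1) g(2)] by (simp only: g(3))
    finally show ?thesis by (rule p_cong_sym)
  qed
  then show ?thesis using \<sigma>(1) unfolding frobenius_def by blast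
qed

lemma frobenius_funpow:
  assumes "frobenius \<sigma>" "x \<in> p_integral"
  shows "p_cong p P ((\<sigma> ^^ i) x) (x ^ (p ^ i))"
proof (induction i)
  case (Suc i)
  have "\<sigma> ^^ i \<in> Gal" using assms(1) by (simp add: frobenius_def)
  then have "(\<sigma> ^^ i) x \<in> p_integral" using assms(2) by (rule p_integral_Gal)
  then have "p_cong p P (\<sigma> ((\<sigma> ^^ i) x)) (((\<sigma> ^^ i) x) ^ p)"
    using assms(1) by (simp add: frobenius_def)
  also have "p_cong p P (((\<sigma> ^^ i) x) ^ p) ((x ^ (p ^ i)) ^ p)" using Suc by (rule p_cong_power)
  finally show ?case by (simp add: power_mult[symmetric] mult.commute)
qed (simp add: assms(2))

lemma frobenius_funpow_fixed_imp_ge: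
  assumes "frobenius \<sigma>" "m > 0" "\<And>x. (\<sigma> ^^ m) x = x"
  shows "residue_degree P \<le> m"
  using finite_residue_field assms(2)
proof (rule residue_degree_le)
  fix x :: 'a assume "algebraic_int x"
  then have "p_cong p P ((\<sigma> ^^ m) x) (x ^ (p ^ m))"
    by (intro frobenius_funpow assms(1) algebraic_int_p_integral)
  then show "p_cong p P (x ^ (p ^ m)) x" unfolding assms(3) by (rule p_cong_sym)
qed

lemma inj_on_frobenius_orbit:
  assumes "frobenius \<sigma>"
  shows "inj_on (\<lambda>i. (\<sigma> ^^ i) \<alpha>) {..<residue_degree P}"
proof -
  have Gal: "\<sigma> ^^ i \<in> Gal" for i using assms by (simp add: frobenius_def)
  have False if ij: "i < j" "j < residue_degree P" "(\<sigma> ^^ i) \<alpha> = (\<sigma> ^^ j) \<alpha>" for i j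
  proof -
    have "\<sigma> ^^ i = \<sigma> ^^ j"
      using inj_onD[OF conjugates_distinct, of "\<sigma> ^^ i" "\<sigma> ^^ j"] ij(3) Gal by simp
    also have "\<dots> = \<sigma> ^^ i \<circ> \<sigma> ^^ (j - i)" using funpow_add[of i "j - i" \<sigma>] ij(1) by simp
    finally have "(\<sigma> ^^ i) ((\<sigma> ^^ (j - i)) x) = (\<sigma> ^^ i) x" for x by (metis comp_apply)
    then have "(\<sigma> ^^ (j - i)) x = x" for x by (simp only: Gal_eq_iff[OF Gal])
    then have "residue_degree P \<le> j - i" using ij(1) by (intro frobenius_funpow_fixed_imp_ge[OF assms]) simp_all
    then show False using ij(1,2) by simp
  qed
  then show ?thesis by (intro inj_onI) (metis lessThan_iff linorder_neqE_nat)
qed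

end

section \<open>Roots of unity\<close>

lemma algebraic_int_root_of_unity:
  assumes "\<zeta> \<in> roots_of_unity"
  shows "algebraic_int \<zeta>"
proof -
  from assms obtain m where m: "m > 0" "\<zeta> ^ m = 1" by (auto simp: roots_of_unity_def)
  show ?thesis
    by (rule algebraic_int_root[of 1 "monom 1 m"])
      (use m in \<open>simp_all add: poly_monom degree_monom_eq int_imp_algebraic_int\<close>)
qed

lemma one_root_of_unity: "1 \<in> roots_of_unity"
  by (auto simp: roots_of_unity_def)

lemma root_of_unity_nonzero: "\<zeta> \<in> roots_of_unity \<Longrightarrow> \<zeta> \<noteq> 0"
  by (auto simp: roots_of_unity_def zero_power)

lemma roots_of_unity_mult:
  assumes "x \<in> roots_of_unity" "y \<in> roots_of_unity"
  shows "x * y \<in> roots_of_unity"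
proof -
  from assms obtain m k where mk: "m > 0" "x ^ m = 1" "k > 0" "y ^ k = 1"
    by (auto simp: roots_of_unity_def)
  then have "x ^ (m * k) = 1" "y ^ (k * m) = 1" by (simp_all add: power_mult)
  then have "(x * y) ^ (m * k) = 1" by (simp add: power_mult_distrib mult.commute)
  then show ?thesis using mk(1,3) unfolding roots_of_unity_def by (intro CollectI exI[of _ "m * k"]) simp
qed

lemma roots_of_unity_power_int:
  assumes "x \<in> roots_of_unity"
  shows "x powi k \<in> roots_of_unity"
proof -
  from assms obtain m where m: "m > 0" "x ^ m = 1" by (auto simp: roots_of_unity_def)
  have "(x powi k) ^ m = (x powi int m) powi k"
    by (simp only: power_int_of_nat[symmetric] power_int_mult[symmetric] mult.commute)
  then have "(x powi k) ^ m = 1" using m by simp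
  then show ?thesis using m unfolding roots_of_unity_def by blast
qed

lemma roots_of_unity_inverse: "x \<in> roots_of_unity \<Longrightarrow> inverse x \<in> roots_of_unity"
  using roots_of_unity_power_int[of x "- 1"] by (simp add: power_int_minus)

lemma obtain_power_of_prime_order:
  fixes x :: "'a::monoid_mult"
  assumes "x ^ m = 1" "m > 0" "x \<noteq> 1"
  obtains k l where "Factorial_Ring.prime l" "(x ^ k) ^ l = 1" "x ^ k \<noteq> 1"
proof -
  have "\<exists>k l. Factorial_Ring.prime l \<and> (x ^ k) ^ l = 1 \<and> x ^ k \<noteq> 1"
    using assms(1,2)
  proof (induction m rule: less_induct)
    case (less m)
    have "m \<noteq> 1" using less.prems assms(3) by auto
    then obtain l where l: "Factorial_Ring.prime l" "l dvd m" using prime_factor_nat by blast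
    then obtain k where k: "m = k * l" by (metis dvd_def mult.commute)
    show ?case
    proof (cases "x ^ k = 1")
      case True
      have "k < m" "k > 0" using k less.prems(2) prime_gt_1_nat[OF l(1)] by auto
      with True show ?thesis using less.IH by blast
    next
      case False
      moreover have "(x ^ k) ^ l = 1" using less.prems(1) k by (simp add: power_mult)
      ultimately show ?thesis using l(1) by blast
    qed
  qed
  then show ?thesis using that by blast
qed

context rational_prime
begin

lemma root_of_unity_p_integral: "\<zeta> \<in> roots_of_unity \<Longrightarrow> \<zeta> \<in> p_integral"
  by (intro algebraic_int_p_integral algebraic_int_root_of_unity)

lemma prime_order_root_cong_one_imp_eq:
  assumes "Factorial_Ring.prime l" "\<xi> ^ l = 1" "\<xi> \<noteq> 1" "p_cong p {of_nat p} \<xi> 1"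
  shows "l = p"
proof -
  have "(\<xi> - 1) * (\<Sum>i<l. \<xi> ^ i) = \<xi> ^ l - 1" by (simp add: power_diff_1_eq)
  then have "(\<Sum>i<l. \<xi> ^ i) = 0" using assms(2,3) by simp
  moreover have "p_cong p {of_nat p} (\<Sum>i<l. \<xi> ^ i) (\<Sum>i<l. 1 ^ i)"
    by (intro mod_p.p_cong_sum mod_p.p_cong_power assms(4))
  ultimately have "p_cong p {of_nat p} (of_int 0 :: 'a) (of_int (int l))" by simp
  then have "[int l = 0] (mod int p)" unfolding p_cong_of_int_iff by (rule cong_sym)
  then have "p dvd l" by (simp add: cong_0_iff)
  then show ?thesis using primes_dvd_imp_eq[OF prime_p assms(1)] by simp
qed

end

lemma root_of_unity_cong_one_two_primes:
  assumes "Factorial_Ring.prime p" "Factorial_Ring.prime q" "p \<noteq> q" and \<zeta>: "\<zeta> \<in> roots_of_unity"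
    and "p_cong p {of_nat p} \<zeta> 1" "p_cong q {of_nat q} \<zeta> 1"
  shows "\<zeta> = 1"
proof (rule ccontr)
  interpret p: rational_prime p by unfold_locales fact
  interpret q: rational_prime q by unfold_locales fact
  assume "\<zeta> \<noteq> 1"
  with \<zeta> obtain k l where kl: "Factorial_Ring.prime l" "(\<zeta> ^ k) ^ l = 1" "\<zeta> ^ k \<noteq> 1"
    unfolding roots_of_unity_def using obtain_power_of_prime_order by blast
  have "p_cong p {of_nat p} (\<zeta> ^ k) 1" "p_cong q {of_nat q} (\<zeta> ^ k) 1"
    using p.mod_p.p_cong_power[OF assms(5), of k] q.mod_p.p_cong_power[OF assms(6), of k] by simp_all
  then have "l = p" "l = q"
    using p.prime_order_root_cong_one_imp_eq[OF kl] q.prime_order_root_cong_one_imp_eq[OF kl] by blast+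
  then show False using assms(3) by simp
qed

context galois_generator
begin

lemma eventually_good_prime: "\<forall>\<^sub>F p in sequentially. Factorial_Ring.prime p \<longrightarrow> good_prime \<alpha> p"
  using eventually_p_integral[of \<alpha>] eventually_p_integral[of "inverse different"]
proof eventually_elim
  case (elim p)
  then show ?case by (intro impI) (unfold_locales, auto)
qed

text \<open>Infinitely many roots of unity would contain two distinct ones congruent modulo two good primes.\<close>

lemma finite_roots_of_unity: "finite (roots_of_unity :: 'a set)"
proof (rule ccontr)
  assume infinite: "infinite (roots_of_unity :: 'a set)"
  obtain N where N: "\<And>p. p \<ge> N \<Longrightarrow> Factorial_Ring.prime p \<Longrightarrow> good_prime \<alpha> p"
    using eventually_good_prime unfolding eventually_sequentially by blast
  obtain p where p: "Factorial_Ring.prime p" "p > N" using bigger_prime by blast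
  obtain q where q: "Factorial_Ring.prime q" "q > p" using bigger_prime by blast
  interpret p: good_prime \<alpha> p using p by (intro N) simp_all
  interpret q: good_prime \<alpha> q using p q by (intro N) simp_all
  obtain B :: "'a set" where B: "B \<subseteq> roots_of_unity" "infinite B"
      "\<forall>x\<in>B. \<forall>y\<in>B. p_cong p {of_nat p} x y"
    using p.infinite_congruent_subset[OF infinite, of "\<lambda>x. x"] p.root_of_unity_p_integral by blast
  obtain C where C: "C \<subseteq> B" "infinite C" "\<forall>x\<in>C. \<forall>y\<in>C. p_cong q {of_nat q} x y"
    using q.infinite_congruent_subset[OF B(2), of "\<lambda>x. x"] q.root_of_unity_p_integral B(1) by blast
  obtain y where y: "y \<in> C" using infinite_imp_nonempty[OF C(2)] by blast
  have "x = y" if x: "x \<in> C" for x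
  proof -
    have roots: "x \<in> roots_of_unity" "y \<in> roots_of_unity" using x y B(1) C(1) by auto
    have inverse: "inverse y \<in> roots_of_unity" using roots(2) by (rule roots_of_unity_inverse)
    have nonzero: "y \<noteq> 0" using roots(2) by (rule root_of_unity_nonzero)
    have "p_cong p {of_nat p} x y" using B(3) C(1) x y by blast
    then have mod_p: "p_cong p {of_nat p} (x * inverse y) 1"
      using p.mod_p.p_cong_mult_right[OF p.root_of_unity_p_integral[OF inverse], of x y] nonzero by simp
    have "p_cong q {of_nat q} x y" using C(3) x y by blast
    then have mod_q: "p_cong q {of_nat q} (x * inverse y) 1"
      using q.mod_p.p_cong_mult_right[OF q.root_of_unity_p_integral[OF inverse], of x y] nonzero by simp
    have "p \<noteq> q" using q(2) by simp
    then have "x * inverse y = 1"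
      using roots_of_unity_mult[OF roots(1) inverse] mod_p mod_q
      by (rule root_of_unity_cong_one_two_primes[OF p(1) q(1)])
    then show ?thesis using nonzero by (simp flip: divide_inverse)
  qed
  then have "C \<subseteq> {y}" by blast
  then show False using C(2) finite_subset by blast
qed

lemma eventually_not_p_cong_root_of_unity:
  fixes Y :: "'a set"
  assumes "finite Y" "Y \<inter> roots_of_unity = {}"
  shows "\<forall>\<^sub>F p in sequentially. Factorial_Ring.prime p \<longrightarrow>
    (\<forall>P\<in>primes_above p. \<forall>y\<in>Y. \<forall>\<zeta>\<in>roots_of_unity. \<not> p_cong p P y \<zeta>)"
proof -
  define \<Theta> where "\<Theta> = (\<lambda>(y, \<zeta>). y - \<zeta>) ` (Y \<times> roots_of_unity)"
  have "finite \<Theta>" unfolding \<Theta>_def using assms(1) finite_roots_of_unity by simp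
  then have "\<forall>\<^sub>F p in sequentially. \<forall>\<theta>\<in>\<Theta>. Factorial_Ring.prime p \<longrightarrow> inverse \<theta> \<in> carrier (p_integers p)"
    using eventually_p_integral by (intro eventually_ball_finite) auto
  then show ?thesis
  proof eventually_elim
    case (elim p)
    show ?case
    proof (intro impI ballI notI)
      fix P :: "'a set" and y \<zeta>
      assume p: "Factorial_Ring.prime p" and P: "P \<in> primes_above p" and y: "y \<in> Y"
        and \<zeta>: "\<zeta> \<in> roots_of_unity" and cong: "p_cong p P y \<zeta>"
      interpret prime_above p P using p P by unfold_locales
      have "y - \<zeta> \<noteq> 0" using assms(2) y \<zeta> by auto
      moreover have "inverse (y - \<zeta>) \<in> p_integral"
        using elim p y \<zeta> unfolding \<Theta>_def by blast
      ultimately have "\<not> p_cong p P (y - \<zeta>) 0" by (rule unit_not_p_cong_zero)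
      then show False using cong p_cong_iff_diff p_cong_p_integral by blast
    qed
  qed
qed

end

section \<open>Cyclotomic polynomials\<close>

lemma Least_pos_dvd:
  fixes S :: "nat set"
  assumes diff: "\<And>a b. a \<in> S \<Longrightarrow> b \<in> S \<Longrightarrow> a \<le> b \<Longrightarrow> b - a \<in> S" and "n \<in> S"
  shows "(LEAST k. k \<ge> 1 \<and> k \<in> S) dvd n"
  using assms(2)
proof (induction n rule: less_induct)
  case (less n)
  define k where "k = (LEAST k. k \<ge> 1 \<and> k \<in> S)"
  have "k dvd n"
  proof (cases "n = 0")
    case False
    then have n: "n \<ge> 1 \<and> n \<in> S" using less.prems by simp
    then have k: "k \<ge> 1 \<and> k \<in> S" unfolding k_def by (rule LeastI)
    have "k \<le> n" unfolding k_def using n by (rule Least_le)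
    then have "n - k \<in> S" "n - k < n" using k n diff by auto
    then have "k dvd n - k" unfolding k_def by (rule less.IH[rotated])
    with \<open>k \<le> n\<close> show ?thesis using dvd_add[of k "n - k" k] by simp
  qed simp
  then show ?case by (simp add: k_def)
qed

lemma degree_monom_minus_one: "h > 0 \<Longrightarrow> degree (monom 1 h - 1 :: 'a::comm_ring_1 poly) = h"
  using degree_add_eq_left[of "- 1" "monom (1 :: 'a) h"] by (simp add: degree_monom_eq)

lemma monic_int_poly_quotient:
  fixes c :: "'b::{idom,ring_char_0} poly"
  assumes "lead_coeff b = 1" "of_int_poly a = of_int_poly b * c"
  shows "\<exists>q. of_int_poly q = c"
proof -
  have b: "b \<noteq> 0" using assms(1) by auto
  obtain q r where qr: "pseudo_divmod a b = (q, r)" by (cases "pseudo_divmod a b")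
  from pseudo_divmod[OF b qr] assms(1) have a: "a = b * q + r" and r: "r = 0 \<or> degree r < degree b"
    by simp_all
  have eq: "of_int_poly r = of_int_poly b * (c - of_int_poly q)"
    using assms(2) unfolding a by (simp add: of_int_poly_hom.hom_add of_int_poly_hom.hom_mult algebra_simps)
  have "c - of_int_poly q = 0"
  proof (rule ccontr)
    assume nz: "c - of_int_poly q \<noteq> 0"
    then have "of_int_poly r \<noteq> (0 :: 'b poly)"
      "degree (of_int_poly r :: 'b poly) = degree b + degree (c - of_int_poly q)"
      unfolding eq using b by (simp_all add: degree_mult_eq)
    then show False using r by auto
  qed
  then show ?thesis by auto
qed

definition cyclotomic_complex :: "nat \<Rightarrow> complex poly" where
  "cyclotomic_complex d = (\<Prod>\<omega>\<in>primitive_roots_of_unity d. [:- \<omega>, 1:])"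

lemma lead_coeff_cyclotomic_complex: "lead_coeff (cyclotomic_complex d) = 1"
  by (simp add: cyclotomic_complex_def lead_coeff_prod)

lemma roots_of_unity_eq_Union_primitive:
  assumes "h > 0"
  shows "{z :: complex. z ^ h = 1} = (\<Union>d\<in>{d. d dvd h}. primitive_roots_of_unity d)"
proof
  show "(\<Union>d\<in>{d. d dvd h}. primitive_roots_of_unity d) \<subseteq> {z. z ^ h = 1}"
    by (auto simp: primitive_roots_of_unity_def elim!: dvdE simp: power_mult)
  show "{z :: complex. z ^ h = 1} \<subseteq> (\<Union>d\<in>{d. d dvd h}. primitive_roots_of_unity d)"
  proof
    fix z :: complex assume "z \<in> {z. z ^ h = 1}"
    then have z: "z ^ h = 1" by simp
    let ?P = "\<lambda>k. k \<ge> 1 \<and> z ^ k = 1"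
    define d where "d = (LEAST k. ?P k)"
    have "?P d" unfolding d_def by (rule LeastI[of ?P h]) (use assms z in simp)
    moreover have "\<not> ?P k" if "k < d" for k using that unfolding d_def by (rule not_less_Least)
    ultimately have "z \<in> primitive_roots_of_unity d"
      by (auto simp: primitive_roots_of_unity_def)
    moreover have "z ^ (b - a) = 1" if "z ^ a = 1" "z ^ b = 1" "a \<le> b" for a b
      using that power_add[of z "b - a" a] by simp
    then have "d dvd h" using Least_pos_dvd[of "{k. z ^ k = 1}" h] z by (simp add: d_def)
    ultimately show "z \<in> (\<Union>d\<in>{d. d dvd h}. primitive_roots_of_unity d)" by blast
  qed
qed

lemma finite_primitive_roots_of_unity:
  assumes "d > 0"
  shows "finite (primitive_roots_of_unity d)"
proof (rule finite_subset)
  show "primitive_roots_of_unity d \<subseteq> {z. z ^ d = 1}" by (auto simp: primitive_roots_of_unity_def)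
  show "finite {z :: complex. z ^ d = 1}" using assms by (intro finite_roots_unity) simp
qed

lemma disjoint_primitive_roots_of_unity:
  assumes "d > 0" "e > 0" "d \<noteq> e"
  shows "primitive_roots_of_unity d \<inter> primitive_roots_of_unity e = {}"
proof -
  have "\<not> k < l" if "k > 0" "z \<in> primitive_roots_of_unity k" "z \<in> primitive_roots_of_unity l" for k l z
    using that by (auto simp: primitive_roots_of_unity_def)
  then show ?thesis using assms by (meson disjoint_iff linorder_neqE_nat)
qed

lemma monom_minus_one_eq_prod_linear:
  assumes "h > 0"
  shows "monom 1 h - 1 = (\<Prod>z\<in>{z. z ^ h = 1}. [:- z, 1 :: complex:])"
proof -
  let ?f = "monom 1 h - 1 :: complex poly"
  have roots: "poly ?f z = 0 \<longleftrightarrow> z ^ h = 1" for z by (simp add: poly_monom)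
  have lead: "lead_coeff ?f = 1" unfolding degree_monom_minus_one[OF assms] using assms by simp
  have "rsquarefree ?f"
    unfolding rsquarefree_roots
  proof (intro allI notI)
    fix a assume a: "poly ?f a = 0 \<and> poly (pderiv ?f) a = 0"
    then have "a ^ h = 1" "of_nat h * a ^ (h - 1) = 0"
      by (simp_all add: poly_monom pderiv_diff pderiv_monom)
    then show False using assms by (auto simp: zero_power)
  qed
  from complex_poly_decompose_rsquarefree[OF this] show ?thesis unfolding lead roots by simp
qed

lemma monom_minus_one_eq_prod_cyclotomic:
  assumes "h > 0"
  shows "monom 1 h - 1 = (\<Prod>d\<in>{d. d dvd h}. cyclotomic_complex d)"
  unfolding monom_minus_one_eq_prod_linear[OF assms] roots_of_unity_eq_Union_primitive[OF assms]
    cyclotomic_complex_def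
  using assms dvd_pos_nat
  by (intro prod.UNION_disjoint ballI impI disjoint_primitive_roots_of_unity finite_primitive_roots_of_unity) auto

lemma cyclotomic_complex_integral:
  "d > 0 \<Longrightarrow> \<exists>q. of_int_poly q = cyclotomic_complex d"
proof (induction d rule: less_induct)
  case (less d)
  let ?E = "{e. e dvd d} - {d}"
  have "e < d \<and> e > 0" if "e \<in> ?E" for e
    using that dvd_imp_le[of e d] dvd_pos_nat[of d e] less.prems by auto
  then have "\<forall>e\<in>?E. \<exists>q. of_int_poly q = cyclotomic_complex e" using less.IH by blast
  then obtain q where q: "\<And>e. e \<in> ?E \<Longrightarrow> of_int_poly (q e) = cyclotomic_complex e"
    by metis
  have "lead_coeff (q e) = 1" if "e \<in> ?E" for e
    using of_int_hom.hom_lead_coeff[of "q e", where 'a=complex] lead_coeff_cyclotomic_complex[of e]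
    by (simp add: q[OF that])
  then have "lead_coeff (\<Prod>e\<in>?E. q e) = 1" by (simp add: lead_coeff_prod)
  moreover have "of_int_poly (monom 1 d - 1) = of_int_poly (\<Prod>e\<in>?E. q e) * cyclotomic_complex d"
  proof -
    have "of_int_poly (monom 1 d - 1) = (monom 1 d - 1 :: complex poly)"
      by (simp add: of_int_poly_hom.hom_minus)
    also have "\<dots> = (\<Prod>e\<in>?E. cyclotomic_complex e) * cyclotomic_complex d"
      unfolding monom_minus_one_eq_prod_cyclotomic[OF less.prems]
      using less.prems by (subst prod.remove[of _ d]) (simp_all add: mult.commute)
    finally show ?thesis using q by (simp add: of_int_poly_hom.hom_prod)
  qed
  ultimately show ?case by (rule monic_int_poly_quotient)
qed

lemma of_int_poly_cyclotomic_poly: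
  assumes "d > 0"
  shows "of_int_poly (cyclotomic_poly d) = cyclotomic_complex d"
proof -
  obtain q where q: "of_int_poly q = cyclotomic_complex d"
    using cyclotomic_complex_integral[OF assms] by blast
  then have "cyclotomic_poly d = q"
    unfolding cyclotomic_poly_def cyclotomic_complex_def[symmetric]
    by (intro the_equality) (auto simp: q[symmetric])
  then show ?thesis using q by simp
qed

lemma primitive_roots_of_unity_nonempty:
  assumes "d > 0"
  shows "primitive_roots_of_unity d \<noteq> {}"
proof (cases "d = 1")
  case True
  then have "1 \<in> primitive_roots_of_unity d" by (auto simp: primitive_roots_of_unity_def)
  then show ?thesis by blast
next
  case False
  let ?f = "\<lambda>k. cis (2 * pi * real k / real d)"
  have bij: "bij_betw ?f {..<d} {z. z ^ d = 1}" using assms by (rule bij_betw_roots_unity)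
  have pow: "?f 1 ^ k = ?f k" for k by (simp add: Complex.DeMoivre mult.commute)
  have "?f 1 ^ k \<noteq> 1" if k: "0 < k" "k < d" for k
  proof
    assume "?f 1 ^ k = 1"
    then have "?f k = ?f 0" unfolding pow by simp
    then show False using bij_betw_imp_inj_on[OF bij] k inj_onD[of ?f "{..<d}" k 0] by simp
  qed
  moreover have "?f 1 ^ d = 1" unfolding pow using assms by simp
  ultimately have "?f 1 \<in> primitive_roots_of_unity d" by (simp add: primitive_roots_of_unity_def)
  then show ?thesis by blast
qed

lemma degree_cyclotomic_poly_pos:
  assumes "d > 0"
  shows "degree (cyclotomic_poly d) > 0"
proof -
  have "degree (cyclotomic_poly d) = degree (cyclotomic_complex d)"
    by (simp flip: of_int_poly_cyclotomic_poly[OF assms])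
  also have "\<dots> = card (primitive_roots_of_unity d)"
    unfolding cyclotomic_complex_def by (subst degree_prod_eq_sum_degree) auto
  finally show ?thesis
    using primitive_roots_of_unity_nonempty[OF assms] finite_primitive_roots_of_unity[OF assms]
    by (simp add: card_gt_0_iff)
qed

definition cyclotomic_cofactor :: "nat \<Rightarrow> nat \<Rightarrow> int poly" where
  "cyclotomic_cofactor h \<delta> = (\<Prod>e\<in>{e. e dvd h} - {\<delta>}. cyclotomic_poly e)"

lemma cyclotomic_cofactor_mult:
  assumes "h > 0" "\<delta> dvd h"
  shows "cyclotomic_cofactor h \<delta> * cyclotomic_poly \<delta> = monom 1 h - 1"
proof -
  have divisor_pos: "e > 0" if "e dvd h" for e using assms(1) that by (rule dvd_pos_nat)
  have "of_int_poly (cyclotomic_cofactor h \<delta> * cyclotomic_poly \<delta>)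
      = (\<Prod>e\<in>{e. e dvd h}. of_int_poly (cyclotomic_poly e) :: complex poly)"
    using assms unfolding cyclotomic_cofactor_def
    by (subst prod.remove[of _ \<delta>]) (simp_all add: of_int_poly_hom.hom_mult of_int_poly_hom.hom_prod mult.commute)
  also have "\<dots> = (\<Prod>e\<in>{e. e dvd h}. cyclotomic_complex e)"
    using divisor_pos by (intro prod.cong refl of_int_poly_cyclotomic_poly) simp
  also have "\<dots> = of_int_poly (monom 1 h - 1)"
    unfolding monom_minus_one_eq_prod_cyclotomic[OF assms(1), symmetric]
    by (simp add: of_int_poly_hom.hom_minus)
  finally show ?thesis by (simp only: of_int_poly_hom.eq_iff)
qed

lemma
  assumes "h > 0" "\<delta> dvd h"
  shows cyclotomic_cofactor_nonzero: "cyclotomic_cofactor h \<delta> \<noteq> 0"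
    and degree_cyclotomic_cofactor_less: "degree (cyclotomic_cofactor h \<delta>) < h"
proof -
  note mult = cyclotomic_cofactor_mult[OF assms]
  have degree: "degree (cyclotomic_cofactor h \<delta> * cyclotomic_poly \<delta>) = h"
    unfolding mult using assms(1) by (rule degree_monom_minus_one)
  then have nonzero: "cyclotomic_cofactor h \<delta> * cyclotomic_poly \<delta> \<noteq> 0" using assms(1) by auto
  then show "cyclotomic_cofactor h \<delta> \<noteq> 0" by simp
  have "\<delta> > 0" using assms by (rule dvd_pos_nat)
  from degree_cyclotomic_poly_pos[OF this] show "degree (cyclotomic_cofactor h \<delta>) < h"
    using degree nonzero by (simp add: degree_mult_eq)
qed

lemma D_quot_eq_poly_cyclotomic_cofactor:
  assumes "h > 0" "\<delta> dvd h" "p \<ge> 2"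
  shows "D_quot h \<delta> p = poly (cyclotomic_cofactor h \<delta>) (int p)"
proof -
  have eq: "int p ^ h - 1 = poly (cyclotomic_cofactor h \<delta>) (int p) * poly (cyclotomic_poly \<delta>) (int p)"
    unfolding poly_mult[symmetric] cyclotomic_cofactor_mult[OF assms(1,2)] by (simp add: poly_monom)
  have "int p ^ h > 1" using assms(1,3) by (intro one_less_power) auto
  then have "poly (cyclotomic_poly \<delta>) (int p) \<noteq> 0" using eq by auto
  then show ?thesis unfolding D_quot_def eq by simp
qed

section \<open>Orders modulo a prime ideal\<close>

context prime_above
begin

definition root_exponents :: "'a \<Rightarrow> nat set" where
  "root_exponents x = {k. \<exists>\<zeta>\<in>roots_of_unity. p_cong p P (x ^ k) \<zeta>}"

lemma root_exponentsI: "p_cong p P (x ^ k) 1 \<Longrightarrow> k \<in> root_exponents x"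
  unfolding root_exponents_def using one_root_of_unity by blast

lemma order_mod_prime_roots_eq_Least:
  "order_mod_prime_roots p P x = (LEAST k. k \<ge> 1 \<and> k \<in> root_exponents x)"
  by (simp add: order_mod_prime_roots_def root_exponents_def)

lemma root_exponents_diff:
  assumes x: "x \<noteq> 0" "inverse x \<in> p_integral"
    and ab: "a \<in> root_exponents x" "b \<in> root_exponents x" "a \<le> b"
  shows "b - a \<in> root_exponents x"
proof -
  from ab obtain \<xi> \<zeta> where \<xi>: "\<xi> \<in> roots_of_unity" "p_cong p P (x ^ a) \<xi>"
    and \<zeta>: "\<zeta> \<in> roots_of_unity" "p_cong p P (x ^ b) \<zeta>"
    by (auto simp: root_exponents_def)
  have "p_cong p P (x ^ b * inverse (x ^ a)) (\<zeta> * inverse \<xi>)"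
    using \<zeta>(2) \<xi> x root_of_unity_nonzero[OF \<xi>(1)] root_of_unity_p_integral[OF roots_of_unity_inverse[OF \<xi>(1)]]
    by (intro p_cong_mult p_cong_inverse) (simp_all flip: power_inverse)
  moreover have "x ^ b * inverse (x ^ a) = x ^ (b - a)"
    using x(1) ab(3) by (simp add: power_diff divide_inverse)
  moreover have "\<zeta> * inverse \<xi> \<in> roots_of_unity"
    using \<zeta>(1) \<xi>(1) by (intro roots_of_unity_mult roots_of_unity_inverse)
  ultimately show ?thesis unfolding root_exponents_def by auto
qed

lemma order_mod_prime_roots_dvd:
  assumes "x \<noteq> 0" "inverse x \<in> p_integral" "k \<in> root_exponents x"
  shows "order_mod_prime_roots p P x dvd k"
  unfolding order_mod_prime_roots_eq_Least
  using root_exponents_diff[OF assms(1,2)] assms(3) by (rule Least_pos_dvd)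

lemma root_exponent_power_int_cong:
  assumes x: "x \<noteq> 0" "inverse x \<in> p_integral" and k: "k \<in> root_exponents x" and "int k dvd N"
  obtains \<zeta> where "\<zeta> \<in> roots_of_unity" "p_cong p P (x powi N) \<zeta>"
proof -
  from k obtain \<zeta> where \<zeta>: "\<zeta> \<in> roots_of_unity" "p_cong p P (x ^ k) \<zeta>" by (auto simp: root_exponents_def)
  from assms(4) obtain t where "N = int k * t" by (elim dvdE)
  then have "x powi N = (x ^ k) powi t" by (simp add: power_int_mult)
  also have "p_cong p P \<dots> (\<zeta> powi t)"
    using \<zeta> x root_of_unity_nonzero[OF \<zeta>(1)] root_of_unity_p_integral[OF roots_of_unity_inverse[OF \<zeta>(1)]]
    by (intro p_cong_power_int) (simp_all flip: power_inverse)
  finally show ?thesis using that[OF roots_of_unity_power_int[OF \<zeta>(1)]] by blast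
qed

end

lemma (in good_prime_above) order_root_exponents:
  assumes "x \<noteq> 0" "x \<in> p_integral" "inverse x \<in> p_integral"
  shows "order_mod_prime_roots p P x \<in> root_exponents x" "order_mod_prime p P x \<in> root_exponents x"
    "order_mod_p p x \<in> root_exponents x"
proof -
  obtain k where k: "k \<ge> 1" "p_cong p {of_nat p} (x ^ k) 1"
    using unit_power_cong_one[OF assms] by blast
  then have k_P: "p_cong p P (x ^ k) 1" by (intro p_cong_if_mod_p)
  have "p_cong p {of_nat p} (x ^ order_mod_p p x) 1"
    unfolding order_mod_p_def by (rule LeastI2[of _ k]) (use k in auto)
  then show "order_mod_p p x \<in> root_exponents x" by (intro root_exponentsI p_cong_if_mod_p)
  have "p_cong p P (x ^ order_mod_prime p P x) 1"
    unfolding order_mod_prime_def by (rule LeastI2[of _ k]) (use k(1) k_P in auto)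
  then show "order_mod_prime p P x \<in> root_exponents x" by (rule root_exponentsI)
  show "order_mod_prime_roots p P x \<in> root_exponents x"
    unfolding order_mod_prime_roots_eq_Least
    by (rule LeastI2[of _ k]) (use k(1) root_exponentsI[OF k_P] in auto)
qed

section \<open>Powers with exponents in the group ring\<close>

text \<open>In multiplicative exponent notation, \<open>orbit_power \<sigma> A x\<close> is \<open>x\<close> raised to \<open>A(\<sigma>)\<close>.\<close>

definition orbit_power :: "('a::field_char_0 \<Rightarrow> 'a) \<Rightarrow> int poly \<Rightarrow> 'a \<Rightarrow> 'a" where
  "orbit_power \<sigma> A x = (\<Prod>i\<le>degree A. (\<sigma> ^^ i) x powi coeff A i)"

lemma orbit_power_not_root_of_unity:
  assumes indep: "mult_independent (conjugates x)"
    and \<sigma>: "\<sigma> \<in> Gal" "inj_on (\<lambda>i. (\<sigma> ^^ i) x) {..degree A}" and "A \<noteq> 0"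
  shows "orbit_power \<sigma> A x \<notin> roots_of_unity"
proof
  let ?f = "\<lambda>i. (\<sigma> ^^ i) x" and ?I = "{..degree A}"
  assume "orbit_power \<sigma> A x \<in> roots_of_unity"
  then obtain m where m: "m > 0" "orbit_power \<sigma> A x ^ m = 1" by (auto simp: roots_of_unity_def)
  define e where "e c = (if c \<in> ?f ` ?I then int m * coeff A (the_inv_into ?I ?f c) else 0)" for c
  have e: "e (?f i) = int m * coeff A i" if "i \<in> ?I" for i
    using that the_inv_into_f_f[OF \<sigma>(2) that] by (simp add: e_def)
  have sub: "?f ` ?I \<subseteq> conjugates x" using \<sigma>(1) by (auto simp: conjugates_def)
  have "(\<Prod>c\<in>conjugates x. c powi e c) = (\<Prod>c\<in>?f ` ?I. c powi e c)"
    using sub mult_independent_finite[OF indep] by (intro prod.mono_neutral_right) (auto simp: e_def)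
  also have "\<dots> = (\<Prod>i\<in>?I. ?f i powi (coeff A i * int m))"
    using e by (simp add: prod.reindex[OF \<sigma>(2)] mult.commute)
  also have "\<dots> = orbit_power \<sigma> A x ^ m"
    unfolding orbit_power_def by (simp only: power_int_mult power_int_of_nat prod_power_distrib)
  finally have "e c = 0" if "c \<in> conjugates x" for c
    using mult_independentD[OF indep, of e] that m(2) by simp
  then have "coeff A i = 0" if "i \<in> ?I" for i
    using that sub e[OF that] m(1) by (auto simp: image_subset_iff)
  then show False using assms(4) leading_coeff_0_iff[of A] by simp
qed

context good_prime_above
begin

lemma orbit_power_frobenius_cong:
  assumes \<sigma>: "frobenius \<sigma>" and x: "x \<noteq> 0" "x \<in> p_integral" "inverse x \<in> p_integral"
  shows "p_cong p P (orbit_power \<sigma> A x) (x powi poly A (int p))"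
proof -
  have "x powi poly A (int p) = (\<Prod>i\<le>degree A. x powi (int p ^ i * coeff A i))"
    using x(1) by (simp add: poly_altdef power_int_sum mult.commute)
  also have "\<dots> = (\<Prod>i\<le>degree A. (x ^ (p ^ i)) powi coeff A i)"
    by (simp only: power_int_mult of_nat_power[symmetric] power_int_of_nat)
  finally have power: "x powi poly A (int p) = (\<Prod>i\<le>degree A. (x ^ (p ^ i)) powi coeff A i)" .
  show ?thesis
    unfolding power orbit_power_def
  proof (intro p_cong_prod p_cong_power_int)
    fix i
    have Gal: "\<sigma> ^^ i \<in> Gal" using \<sigma> by (simp add: frobenius_def)
    show "p_cong p P ((\<sigma> ^^ i) x) (x ^ (p ^ i))" using \<sigma> x(2) by (rule frobenius_funpow)
    show "(\<sigma> ^^ i) x \<noteq> 0" "x ^ (p ^ i) \<noteq> 0" using x(1) Gal_eq_zero_iff[OF Gal] by simp_all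
    show "inverse ((\<sigma> ^^ i) x) \<in> p_integral"
      using p_integral_Gal[OF Gal x(3)] by (simp add: Gal_inverse[OF Gal])
    show "inverse (x ^ (p ^ i)) \<in> p_integral" using x(3) by (simp flip: power_inverse)
  qed
qed

lemma root_exponent_not_dvd_poly:
  assumes \<sigma>: "frobenius \<sigma>" and x: "x \<noteq> 0" "x \<in> p_integral" "inverse x \<in> p_integral"
    and "\<forall>\<zeta>\<in>roots_of_unity. \<not> p_cong p P (orbit_power \<sigma> A x) \<zeta>" and k: "k \<in> root_exponents x"
  shows "\<not> int k dvd poly A (int p)"
proof
  assume "int k dvd poly A (int p)"
  then obtain \<zeta> where "\<zeta> \<in> roots_of_unity" "p_cong p P (x powi poly A (int p)) \<zeta>"
    using root_exponent_power_int_cong[OF x(1,3) k] by blast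
  then show False using assms(5) p_cong_trans[OF orbit_power_frobenius_cong[OF \<sigma> x]] by blast
qed

lemma order_mod_prime_roots_dvd_card_residue_units:
  assumes "x \<noteq> 0" "x \<in> p_integral" "inverse x \<in> p_integral"
  shows "order_mod_prime_roots p P x dvd p ^ residue_degree P - 1"
  using assms(1,3)
  by (rule order_mod_prime_roots_dvd)
    (intro root_exponentsI p_cong_fermat finite_residue_field assms(2) unit_not_p_cong_zero[OF assms(1,3)])

end

locale independent_galois_generator = galois_generator \<eta> for \<eta> :: "'a::field_char_0" +
  assumes eta_nonzero: "\<eta> \<noteq> 0"
    and conjugates_mult_independent: "mult_independent (conjugates \<eta>)"
begin

definition cofactor_powers :: "nat \<Rightarrow> 'a set" where
  "cofactor_powers h = (\<lambda>(\<sigma>, \<delta>). orbit_power \<sigma> (cyclotomic_cofactor h \<delta>) \<eta>) `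
     ({\<sigma> \<in> Gal. inj_on (\<lambda>i. (\<sigma> ^^ i) \<eta>) {..<h}} \<times> {\<delta>. \<delta> dvd h})"

lemma finite_cofactor_powers: "h > 0 \<Longrightarrow> finite (cofactor_powers h)"
  unfolding cofactor_powers_def using finite_Gal by simp

lemma cofactor_powers_disjoint_roots_of_unity:
  assumes "h > 0"
  shows "cofactor_powers h \<inter> roots_of_unity = {}"
proof -
  have "orbit_power \<sigma> (cyclotomic_cofactor h \<delta>) \<eta> \<notin> roots_of_unity"
    if \<sigma>: "\<sigma> \<in> Gal" "inj_on (\<lambda>i. (\<sigma> ^^ i) \<eta>) {..<h}" and \<delta>: "\<delta> dvd h" for \<sigma> \<delta>
  proof (rule orbit_power_not_root_of_unity[OF conjugates_mult_independent \<sigma>(1)])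
    show "inj_on (\<lambda>i. (\<sigma> ^^ i) \<eta>) {..degree (cyclotomic_cofactor h \<delta>)}"
      using degree_cyclotomic_cofactor_less[OF assms \<delta>] by (intro inj_on_subset[OF \<sigma>(2)]) auto
    show "cyclotomic_cofactor h \<delta> \<noteq> 0" using assms \<delta> by (rule cyclotomic_cofactor_nonzero)
  qed
  then show ?thesis by (auto simp: cofactor_powers_def)
qed

end

locale independent_generator_above =
  independent_galois_generator \<eta> + good_prime_above \<eta> p P
  for \<eta> :: "'a::field_char_0" and p :: nat and P :: "'a set" +
  assumes inverse_generator_p_integral: "inverse \<eta> \<in> p_integral"
begin

lemmas generator_unit = eta_nonzero generator_p_integral inverse_generator_p_integral

lemma root_exponent_not_dvd_D_quot:
  assumes "residue_degree P = h" "h > 0" "\<delta> dvd h" "k \<in> root_exponents \<eta>"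
    and "\<forall>y\<in>cofactor_powers h. \<forall>\<zeta>\<in>roots_of_unity. \<not> p_cong p P y \<zeta>"
  shows "\<not> int k dvd D_quot h \<delta> p"
proof -
  obtain \<sigma> where \<sigma>: "frobenius \<sigma>" using frobenius_exists by blast
  then have "orbit_power \<sigma> (cyclotomic_cofactor h \<delta>) \<eta> \<in> cofactor_powers h"
    using inj_on_frobenius_orbit[OF \<sigma>] assms(1,3) unfolding cofactor_powers_def frobenius_def by auto
  then have "\<not> int k dvd poly (cyclotomic_cofactor h \<delta>) (int p)"
    using assms(4,5) by (intro root_exponent_not_dvd_poly[OF \<sigma> generator_unit]) auto
  then show ?thesis
    using D_quot_eq_poly_cyclotomic_cofactor[OF assms(2,3) prime_ge_2_nat[OF prime_p]] by simp
qed

end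

lemma (in independent_galois_generator) eventually_independent_generator_above:
  "\<forall>\<^sub>F p in sequentially. Factorial_Ring.prime p \<longrightarrow>
     (\<forall>P\<in>primes_above p. independent_generator_above \<eta> p P)"
  using eventually_good_prime eventually_p_integral[of "inverse \<eta>"]
proof eventually_elim
  case (elim p)
  show ?case
  proof (intro impI ballI)
    fix P :: "'a set" assume p: "Factorial_Ring.prime p" and P: "P \<in> primes_above p"
    interpret good_prime \<eta> p using elim(1) p by blast
    show "independent_generator_above \<eta> p P"
      using P elim(2) p by unfold_locales auto
  qed
qed

lemma independent_galois_generator_if_rank:
  fixes \<eta> :: "'a::field_char_0"
  assumes galois: "finite_galois_over_rat TYPE('a)" and "\<eta> \<noteq> 0"
    and rank: "has_mult_rank (galois_module \<eta>) (degree_over_rat TYPE('a))"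
  shows "independent_galois_generator \<eta>"
proof
  note conjugates = mult_independent_conjugates[OF assms]
  show distinct: "inj_on (\<lambda>\<sigma>. \<sigma> \<eta>) Gal"
    using span_powers_if_card_conjugates_eq_degree[OF galois conjugates(2)] by (rule inj_on_Gal_if_span_powers)
  have "finite (conjugates \<eta>)" using conjugates(1) by (rule mult_independent_finite)
  then show "finite (Gal :: ('a \<Rightarrow> 'a) set)"
    using distinct unfolding conjugates_def by (rule finite_imageD)
  show "x \<in> \<rat>" if "\<And>\<sigma>. \<sigma> \<in> Gal \<Longrightarrow> \<sigma> x = x" for x :: 'a
    using that galois by (auto simp: finite_galois_over_rat_def Rats_def)
qed (fact mult_independent_conjugates(1)[OF assms] assms(2))+

lemma degree_over_rat_pos:
  assumes "finite_galois_over_rat TYPE('a::field_char_0)"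
  shows "degree_over_rat TYPE('a) > 0"
proof -
  obtain B where "finite_dimensional_vector_space (rat_scale :: rat \<Rightarrow> 'a \<Rightarrow> 'a) B"
    using finite_galois_obtain_basis[OF assms] .
  then interpret finite_dimensional_vector_space "rat_scale :: rat \<Rightarrow> 'a \<Rightarrow> 'a" B .
  have "rat_vs.independent {1 :: 'a}" using rat_vs.dependent_single[of "1 :: 'a"] by simp
  from independent_card_le_dim[OF subset_UNIV this] show ?thesis
    by (simp only: degree_over_rat_def card.insert) simp
qed

theorem theorem2p1:
  fixes \<eta> :: "'a::field_char_0" and n h :: nat
  assumes "finite_galois_over_rat TYPE('a)"
    and "degree_over_rat TYPE('a) = n"
    and "h dvd n"
    and "\<exists>H. subgroup H (galois_group :: ('a \<Rightarrow> 'a) monoid) \<and>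
           cyclic_group ((galois_group :: ('a \<Rightarrow> 'a) monoid)\<lparr>carrier := H\<rparr>) \<and> card H = h"
    and "\<eta> \<noteq> 0"
    and "has_mult_rank (galois_module \<eta>) n"
  shows "\<forall>\<^sub>F p in sequentially.
           Factorial_Ring.prime p \<and> unramified TYPE('a) p \<and> prime_to p \<eta> \<and>
           has_residue_degree TYPE('a) p h \<longrightarrow>
           (\<forall>P \<in> primes_above p.
              order_mod_prime_roots p P \<eta> dvd p ^ h - 1 \<and>
              (\<forall>\<delta>. \<delta> dvd h \<longrightarrow>
                 \<not> int (order_mod_prime_roots p P \<eta>) dvd D_quot h \<delta> p \<and>
                 \<not> int (order_mod_prime p P \<eta>) dvd D_quot h \<delta> p \<and>
                 \<not> int (order_mod_p p \<eta>) dvd D_quot h \<delta> p))"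
proof -
  interpret independent_galois_generator \<eta>
    using assms by (intro independent_galois_generator_if_rank) simp_all
  have h_pos: "h > 0" using assms(2,3) degree_over_rat_pos[OF assms(1)] by (metis dvd_pos_nat)
  show ?thesis
    using eventually_independent_generator_above
      eventually_not_p_cong_root_of_unity[OF finite_cofactor_powers[OF h_pos]
        cofactor_powers_disjoint_roots_of_unity[OF h_pos]]
  proof eventually_elim
    case (elim p)
    show ?case
    proof (intro impI ballI)
      fix P :: "'a set"
      assume p: "Factorial_Ring.prime p \<and> unramified TYPE('a) p \<and> prime_to p \<eta> \<and>
          has_residue_degree TYPE('a) p h" and P: "P \<in> primes_above p"
      interpret independent_generator_above \<eta> p P using elim(1) p P by blast
      have degree: "residue_degree P = h" using p P by (simp add: has_residue_degree_def)
      have "\<not> int k dvd D_quot h \<delta> p" if "\<delta> dvd h" "k \<in> root_exponents \<eta>" for k \<delta>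
        using degree h_pos that elim(2) p P by (intro root_exponent_not_dvd_D_quot) auto
      then show "order_mod_prime_roots p P \<eta> dvd p ^ h - 1 \<and> (\<forall>\<delta>. \<delta> dvd h \<longrightarrow>
          \<not> int (order_mod_prime_roots p P \<eta>) dvd D_quot h \<delta> p \<and>
          \<not> int (order_mod_prime p P \<eta>) dvd D_quot h \<delta> p \<and> \<not> int (order_mod_p p \<eta>) dvd D_quot h \<delta> p)"
        using order_mod_prime_roots_dvd_card_residue_units[OF generator_unit]
          order_root_exponents[OF generator_unit] degree by simp
    qed
  qed
qed

end
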